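(* Let $0<q<1$, $r\ge 1$, $\vec n=(n_1,\dots,n_r)\in\mathbb{N}^r$ (with $0\in\mathbb N$), and $|\vec n|=n_1+\cdots+n_r$. Let $\vec a=(a_1,\dots,a_r)$ and $b$ be parameters with $|a_j|,|b|<1$, $b\neq 0$, $a_j=q^{\alpha_j}$ (so $a_j\ne 0$), and $\alpha_i-\alpha_j\notin\mathbb{Z}$ for $i\ne j$ (meaning that $a_i/a_j$ is not an integer power of $q$ for $i\neq j$). Then the multiple Al-Salam--Chihara polynomial $p_{\vec n}(x;\vec a,b|q)$ for the weights $w(\theta;a_1,b|q),\dots,w(\theta;a_r,b|q)$ is given by $$p_{\vec n}(x;\vec a,b|q)=T_{b}\,q_{\vec n}\left(x;\tfrac{b}{q}\vec a\,\middle|\,q\right),$$ that is, the polynomial on the right-hand side has degree $|\vec n|$ and satisfies $$\int_{-1}^1 p_{\vec n}(x;\vec a,b|q)\,x^\ell\, w(\theta;a_j,b|q)\,\frac{dx}{\sqrt{1-x^2}}=0,\qquad 0\le \ell\le n_j-1,\ 1\le j\le r,\quad x=\cos\theta .$$ Moreover, with $x=\cos\theta$ and $|\vec k|=k_1+\cdots+k_r$, it has the explicit expression $$p_{\vec n}(x;\vec a,b|q)=\sum_{k_1=0}^{n_1}\cdots\sum_{k_r=0}^{n_r}\ \prod_{j=1}^r\frac{(q^{-n_j};q)_{k_j}}{(q;q)_{k_j}(a_jb;q)_{k_j}}\ \prod_{j=1}^{r-1}\frac{(a_jbq^{n_j};q)_{k_{j+1}+\cdots+k_r}}{(a_jbq^{k_j};q)_{k_{j+1}+\cdots+k_r}}\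 \frac{q^{|\vec k|}}{q^{\sum_{j=1}^r n_j\sum_{i=j+1}^r k_i}}\ (be^{i\theta},be^{-i\theta};q)_{|\vec k|} .$$
   Context: Notation: $(z;q)_k=\prod_{j=0}^{k-1}(1-zq^j)$, $(z;q)_\infty=\prod_{j\ge0}(1-zq^j)$, $(z_1,\dots,z_m;q)_k=\prod_i (z_i;q)_k$ (also for $k=\infty$). Al-Salam--Chihara weight ($x=\cos\theta$): $$w(\theta;a,b|q)=\frac{(e^{2i\theta},e^{-2i\theta};q)_\infty}{(ae^{i\theta},ae^{-i\theta},be^{i\theta},be^{-i\theta};q)_\infty}.$$ $T_{b}$ is the linear map on polynomials in $x$ determined by $T_{b}(x^k)=(be^{i\theta},be^{-i\theta};q)_k=\prod_{j=0}^{k-1}(1+b^2q^{2j}-2bq^jx)$, a polynomial in $x=\cos\theta$. Multiple little $q$-Laguerre polynomials: for $\vec A=(A_1,\dots,A_r)$ with $0<|A_jq|<1$ and $A_i/A_j$ not an integer power of $q$ for $i\ne j$, $q_{\vec n}(x;\vec A|q)$ is the polynomial of degree $|\vec n|$, normalized by $q_{\vec n}(0;\vec A|q)=1$, which satisfies $$\sum_{k=0}^\infty q_{\vec n}(q^k;\vec A|q)\,q^{k\ell}\,\frac{(A_jq)^k}{(q;q)_k}=0,\qquad 0\le\ell\le n_j-1,\ 1\le j\le r;$$ these conditions determine it uniquely. Here $\frac bq\vec a=(\frac{a_1b}{q},\dots,\frac{a_rb}{q})$. The multiple (type II) Al-Salam--Chihara polynomial for $\vec n$ is the polynomial of degree $|\vec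 n|$ satisfying the displayed integral orthogonality conditions; under the stated assumptions these determine it uniquely up to a multiplicative constant. *)

theory Defs
  imports "HOL-Analysis.Analysis" "HOL-Computational_Algebra.Polynomial"
begin

definition qpoch :: "complex \<Rightarrow> real \<Rightarrow> nat \<Rightarrow> complex" where
  "qpoch z q k = (\<Prod>j<k. 1 - z * of_real q ^ j)"

definition qpoch_inf :: "complex \<Rightarrow> real \<Rightarrow> complex" where
  "qpoch_inf z q = (\<Prod>j. 1 - z * of_real q ^ j)"

definition asc_weight :: "real \<Rightarrow> complex \<Rightarrow> complex \<Rightarrow> real \<Rightarrow> complex" where
  "asc_weight \<theta> a b q =
     qpoch_inf (cis (2 * \<theta>)) q * qpoch_inf (cis (- 2 * \<theta>)) q /
     (qpoch_inf (a * cis \<theta>) q * qpoch_inf (a * cis (- \<theta>)) q *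
      qpoch_inf (b * cis \<theta>) q * qpoch_inf (b * cis (- \<theta>)) q)"

definition asc_basis :: "complex \<Rightarrow> real \<Rightarrow> nat \<Rightarrow> complex poly" where
  "asc_basis b q k = (\<Prod>j<k. [: 1 + b ^ 2 * of_real q ^ (2 * j), - 2 * b * of_real q ^ j :])"

definition asc_T :: "complex \<Rightarrow> real \<Rightarrow> complex poly \<Rightarrow> complex poly" where
  "asc_T b q p = (\<Sum>k\<le>degree p. smult (coeff p k) (asc_basis b q k))"

lemma poly_asc_basis_cos:
  "poly (asc_basis b q k) (of_real (cos \<theta>)) = qpoch (b * cis \<theta>) q k * qpoch (b * cis (- \<theta>)) q k"
proof -
  have cs: "cis \<theta> + cis (- \<theta>) = 2 * of_real (cos \<theta>)" "cis \<theta> * cis (- \<theta>) = 1"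
    by (simp_all add: complex_eq_iff cis_mult)
  have "1 + b ^ 2 * of_real q ^ (2 * j) - 2 * b * of_real q ^ j * of_real (cos \<theta>) =
        (1 - b * cis \<theta> * of_real q ^ j) * (1 - b * cis (- \<theta>) * of_real q ^ j)" for j
  proof -
    define Q where "Q = (of_real q :: complex) ^ j"
    have Q2: "(of_real q :: complex) ^ (2 * j) = Q ^ 2"
      by (simp add: Q_def mult.commute flip: power_mult)
    have "(1 - b * cis \<theta> * Q) * (1 - b * cis (- \<theta>) * Q) =
          1 - b * Q * (cis \<theta> + cis (- \<theta>)) + b ^ 2 * Q ^ 2 * (cis \<theta> * cis (- \<theta>))"
      by (simp add: algebra_simps power2_eq_square)
    then show ?thesis
      unfolding Q2 Q_def [symmetric] cs by (simp add: algebra_simps)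
  qed
  then show ?thesis
    by (simp add: asc_basis_def qpoch_def poly_prod mult.commute [of "of_real (cos \<theta>)"] flip: prod.distrib)
qed

lemma asc_T_upto:
  assumes "degree p \<le> N"
  shows "asc_T b q p = (\<Sum>k\<le>N. smult (coeff p k) (asc_basis b q k))"
  unfolding asc_T_def using assms
  by (intro sum.mono_neutral_left) (auto simp: coeff_eq_0)

lemma asc_T_add: "asc_T b q (p + s) = asc_T b q p + asc_T b q s"
  using asc_T_upto [of p "max (degree p) (degree s)" b q]
    asc_T_upto [of s "max (degree p) (degree s)" b q]
    asc_T_upto [of "p + s" "max (degree p) (degree s)" b q]
  by (simp add: degree_add_le smult_add_left sum.distrib)

lemma asc_T_smult: "asc_T b q (smult c p) = smult c (asc_T b q p)"
  by (cases "c = 0") (simp_all add: asc_T_def poly_eq_iff coeff_sum sum_distrib_left mult.assoc)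

lemma asc_T_monom: "asc_T b q (monom 1 k) = asc_basis b q k"
proof -
  have "asc_T b q (monom 1 k) = (\<Sum>i\<le>k. if i = k then asc_basis b q i else 0)"
    unfolding asc_T_def by (intro sum.cong) (auto simp: degree_monom_eq)
  then show ?thesis by simp
qed

text \<open>A multi-index or parameter vector of length \<open>r\<close> is a function on \<open>nat\<close> of which only the
  values at \<open>1, \<dots>, r\<close> matter.\<close>

definition is_mult_little_q_laguerre ::
    "nat \<Rightarrow> (nat \<Rightarrow> nat) \<Rightarrow> (nat \<Rightarrow> complex) \<Rightarrow> real \<Rightarrow> complex poly \<Rightarrow> bool" where
  "is_mult_little_q_laguerre r n A q p \<longleftrightarrow>
     degree p = (\<Sum>j=1..r. n j) \<and> poly p 0 = 1 \<and>
     (\<forall>j\<in>{1..r}. \<forall>l<n j.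
        (\<lambda>k. poly p (of_real q ^ k) * of_real q ^ (k * l) *
              ((A j * of_real q) ^ k / qpoch (of_real q) q k)) sums 0)"

text \<open>Uniquely determined, hence meaningful, when \<open>0 < q < 1\<close>, \<open>0 < norm (A j * q) < 1\<close> and no
  quotient \<open>A i / A j\<close> with \<open>i \<noteq> j\<close> is an integer power of \<open>q\<close>.\<close>

definition mult_little_q_laguerre ::
    "nat \<Rightarrow> (nat \<Rightarrow> nat) \<Rightarrow> (nat \<Rightarrow> complex) \<Rightarrow> real \<Rightarrow> complex poly" where
  "mult_little_q_laguerre r n A q = (THE p. is_mult_little_q_laguerre r n A q p)"

text \<open>These conditions fix \<open>p\<close> only up to a nonzero constant factor. Here \<open>\<theta> = arccos x\<close>, and
  \<open>has_integral\<close> includes the convergence of the integral; the totalised value of the integrand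
  at \<open>x = -1\<close> and \<open>x = 1\<close> is irrelevant. For complex parameters the pairing is bilinear.\<close>

definition is_mult_al_salam_chihara ::
    "nat \<Rightarrow> (nat \<Rightarrow> nat) \<Rightarrow> (nat \<Rightarrow> complex) \<Rightarrow> complex \<Rightarrow> real \<Rightarrow> complex poly \<Rightarrow> bool" where
  "is_mult_al_salam_chihara r n a b q p \<longleftrightarrow>
     degree p = (\<Sum>j=1..r. n j) \<and>
     (\<forall>j\<in>{1..r}. \<forall>l<n j.
        ((\<lambda>x. poly p (of_real x) * of_real x ^ l * asc_weight (arccos x) (a j) b q /
               of_real (sqrt (1 - x\<^sup>2))) has_integral 0) {-1..1})"

end

theory Submission
  imports Defs "HOL-Complex_Analysis.Complex_Analysis"
begin

text \<open>
  Write \<open>Q\<close> for \<open>q\<close> as a complex number and \<open>t\<^sub>j = a\<^sub>j b\<close>. The proof rests on the observation that both kinds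
  of orthogonality say the same thing about one auxiliary polynomial. Let \<open>L\<close> be the linear map
  that sends \<open>x ^ m\<close> to \<open>(x; q)\<^sub>m\<close>.

  For the little \<open>q\<close>-Laguerre weight, the series \<open>e(t) = \<Sum>k. t ^ k / (q; q)\<^sub>k\<close> satisfies
  \<open>e(t Q) = (1 - t) e(t)\<close>, so the moment of \<open>p\<close> of order \<open>l\<close> against the weight with parameter \<open>t\<close> is
  \<open>e(t) (t; q)\<^sub>l (L p)(t Q ^ l)\<close> with nonzero factors in front (\<open>little_q_laguerre_moment\<close>).
  For the Al-Salam--Chihara weight, the total mass \<open>I(a, b)\<close> satisfies \<open>I(a Q, b) = (1 - a b) I(a, b)\<close>,
  and multiplying the weight by a basis polynomial shifts \<open>a\<close> or \<open>b\<close> by a power of \<open>Q\<close>. Hence the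
  integral of the image of \<open>p\<close> under \<open>T\<^sub>b\<close> against the basis polynomial
  \<open>(a e\<^sup>i\<^sup>\<theta>, a e\<^sup>-\<^sup>i\<^sup>\<theta>; q)\<^sub>l\<close> is
  \<open>I(a, b) (a b; q)\<^sub>l (L p)(a b Q ^ l)\<close> (\<open>asc_orthogonality_pairing\<close>).

  In both cases the conditions therefore follow from, and in the first case are equivalent to, the
  vanishing of \<open>L p\<close> at the points \<open>t\<^sub>j Q ^ l\<close> with \<open>l < n\<^sub>j\<close>. These are \<open>|n|\<close> distinct points, all
  different from \<open>1\<close>, and \<open>p(0) = (L p)(1)\<close>. So the little \<open>q\<close>-Laguerre polynomial is the unique \<open>p\<close> for
  which \<open>L p\<close> is the product over \<open>j\<close> and \<open>l < n\<^sub>j\<close> of \<open>(x - t\<^sub>j Q ^ l) / (1 - t\<^sub>j Q ^ l)\<close>.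
  Its coefficients are those of this product in the basis \<open>(x; q)\<^sub>m\<close>; they are found by summing one index
  at a time with the \<open>q\<close>-Chu--Vandermonde formula (\<open>multiple_q_chu_vandermonde\<close>).

  The recurrence for the total mass is the only place that needs complex analysis. It amounts to the vanishing
  of the integral of \<open>2 cos \<theta> - a - b\<close> against the weight, and this holds because that integrand is
  a difference \<open>G(z) - G(z / Q)\<close> on the unit circle, with \<open>G\<close> holomorphic on the annulus
  \<open>1 \<le> |z| \<le> 1 / q\<close> (\<open>asc_primitive_diff\<close>, \<open>circle_mean_eq\<close>).
\<close>

section \<open>Finite q-shifted factorials and the q-Chu--Vandermonde formula\<close>

lemma qpoch_0 [simp]: "qpoch z q 0 = 1"
  by (simp add: qpoch_def)

lemma qpoch_Suc: "qpoch z q (Suc k) = qpoch z q k * (1 - z * of_real q ^ k)"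
  by (simp add: qpoch_def)

lemma qpoch_add: "qpoch z q (m + k) = qpoch z q m * qpoch (z * of_real q ^ m) q k"
  by (induction k) (simp_all add: qpoch_Suc power_add mult.assoc)

lemma qpoch_Suc_shift: "qpoch z q (Suc k) = (1 - z) * qpoch (z * of_real q) q k"
  using qpoch_add [of z q 1 k] by (simp add: qpoch_Suc)

lemma qpoch_shift_nonzero:
  assumes "\<And>k. qpoch z q k \<noteq> 0"
  shows "qpoch (z * of_real q ^ m) q k \<noteq> 0"
  using assms [of "m + k"] by (simp add: qpoch_add)

lemma one_minus_times_power_nonzero:
  assumes "norm z < 1" "0 < q" "q < 1"
  shows "1 - z * of_real q ^ k \<noteq> (0::complex)"
proof -
  have "norm (z * of_real q ^ k) \<le> norm z * 1"
    unfolding norm_mult norm_power using assms by (intro mult_left_mono power_le_one) auto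
  with assms have "norm (z * of_real q ^ k) \<noteq> norm (1::complex)" by simp
  then show ?thesis by auto
qed

lemma qpoch_nonzero:
  assumes "norm z < 1" "0 < q" "q < 1"
  shows "qpoch z q k \<noteq> 0"
  using one_minus_times_power_nonzero [OF assms] by (simp add: qpoch_def)

text \<open>Induction on \<open>n\<close>: a Pascal-type rule for the coefficients in \<open>n\<close> splits the sum for \<open>n + 1\<close> into
  the sum for \<open>n\<close> and a multiple of the sum for \<open>n\<close> in which \<open>x\<close> and \<open>c\<close> are both multiplied by \<open>q\<close>.
  Since \<open>(x - c q\<^sup>l) / (1 - c q\<^sup>l)\<close> keeps its numerator up to a factor \<open>q\<close> under that
  substitution, the two products combine.\<close>
lemma q_chu_vandermonde:
  assumes q: "0 < q" "q < 1" and c: "\<And>k. qpoch c q k \<noteq> 0"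
  shows "(\<Sum>k\<le>n. qpoch (of_real q powi (- int n)) q k / qpoch (of_real q) q k * of_real q ^ k *
            (qpoch x q k / qpoch c q k)) =
         (\<Prod>l<n. (x - c * of_real q ^ l) / (1 - c * of_real q ^ l))"
  using c
proof (induction n arbitrary: x c)
  case (Suc n)
  define Q where "Q = complex_of_real q"
  have Q0: "Q \<noteq> 0" using q by (simp add: Q_def)
  \<comment> \<open>a version of the \<open>q\<close>-binomial coefficient, with sign and power of \<open>q\<close> included\<close>
  define u where "u = (\<lambda>n k. qpoch (Q powi (- int n)) q k / qpoch Q q k * Q ^ k)"
  have nz: "qpoch Q q k \<noteq> 0" for k
    using qpoch_nonzero [of Q q k] q by (simp add: Q_def)
  have u0: "u n (Suc n) = 0"
  proof -
    have "qpoch (Q powi (- int n)) q (Suc n) = 0"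
      by (simp add: qpoch_Suc Q_def [symmetric] power_int_minus Q0)
    then show ?thesis by (simp add: u_def)
  qed
  have pascal: "u (Suc n) (Suc k) = u n (Suc k) - Q powi (- int n) * u n k" for k
  proof -
    have Qn: "Q powi (- int (Suc n)) * Q = Q powi (- int n)"
      using Q0 by (simp add: power_int_minus field_simps del: of_nat_Suc)
    have e1: "qpoch (Q powi (- int (Suc n))) q (Suc k) =
        (1 - Q powi (- int (Suc n))) * qpoch (Q powi (- int n)) q k"
      using qpoch_Suc_shift [of "Q powi (- int (Suc n))" q k] Qn by (simp add: Q_def)
    have e2: "qpoch (Q powi (- int n)) q (Suc k) =
        qpoch (Q powi (- int n)) q k * (1 - Q powi (- int n) * Q ^ k)"
      by (simp add: qpoch_Suc Q_def)
    have e3: "qpoch Q q (Suc k) = qpoch Q q k * (1 - Q * Q ^ k)"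
      by (simp add: qpoch_Suc Q_def)
    have e4: "1 - Q * Q ^ k \<noteq> 0" using nz [of "Suc k"] e3 by auto
    define y where "y = Q powi (- int (Suc n))"
    have y: "Q powi (- int n) = y * Q" using Qn by (simp add: y_def)
    define A where "A = qpoch (Q powi (- int n)) q k"
    have "(1 - y) * A / (qpoch Q q k * (1 - Q * Q ^ k)) * (Q * Q ^ k) =
       A * (1 - y * Q * Q ^ k) / (qpoch Q q k * (1 - Q * Q ^ k)) * (Q * Q ^ k)
       - y * Q * (A / qpoch Q q k * Q ^ k)"
      using nz [of k] e4 by (simp add: divide_simps) (simp add: algebra_simps)
    then show ?thesis
      unfolding u_def e1 e2 e3 power_Suc unfolding A_def [symmetric]
      unfolding y_def [symmetric] y .
  qed
  have u_at_0: "u m 0 = 1" for m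
    by (simp add: u_def)
  define f where "f = (\<lambda>n x c. \<Sum>k\<le>n. u n k * (qpoch x q k / qpoch c q k))"
  have IH: "f n x c = (\<Prod>l<n. (x - c * Q ^ l) / (1 - c * Q ^ l))"
    if "\<And>k. qpoch c q k \<noteq> 0" for x c
    using Suc.IH [OF that, of x] by (simp add: f_def u_def Q_def)
  have c0: "c \<noteq> 1" using Suc.prems [of 1] by (auto simp: qpoch_Suc)
  have shiftne: "qpoch (c * Q) q k \<noteq> 0" for k
    using Suc.prems [of "Suc k"] by (simp add: qpoch_Suc_shift Q_def)
  have "f (Suc n) x c = u (Suc n) 0 + (\<Sum>k\<le>n. u (Suc n) (Suc k) * (qpoch x q (Suc k) / qpoch c q (Suc k)))"
    by (simp only: f_def sum.atMost_Suc_shift) simp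
  also have "\<dots> = (u n 0 + (\<Sum>k\<le>n. u n (Suc k) * (qpoch x q (Suc k) / qpoch c q (Suc k))))
       - Q powi (- int n) * (\<Sum>k\<le>n. u n k * (qpoch x q (Suc k) / qpoch c q (Suc k)))"
    by (simp only: pascal left_diff_distrib sum_subtractf sum_distrib_left mult.assoc u_at_0)
       (simp only: algebra_simps)
  also have "u n 0 + (\<Sum>k\<le>n. u n (Suc k) * (qpoch x q (Suc k) / qpoch c q (Suc k))) =
      (\<Sum>k\<le>Suc n. u n k * (qpoch x q k / qpoch c q k))"
    by (simp only: sum.atMost_Suc_shift) simp
  also have "\<dots> = f n x c" by (simp add: f_def u0)
  also have "(\<Sum>k\<le>n. u n k * (qpoch x q (Suc k) / qpoch c q (Suc k))) =
      (1 - x) / (1 - c) * f n (x * Q) (c * Q)"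
    unfolding f_def sum_distrib_left qpoch_Suc_shift Q_def [symmetric]
    by (intro sum.cong refl) simp
  also have "f n (x * Q) (c * Q) = (\<Prod>l<n. (x * Q - c * Q * Q ^ l) / (1 - c * Q * Q ^ l))"
    by (rule IH) (rule shiftne)
  also have "\<dots> = (\<Prod>l<n. Q * ((x - c * Q ^ l) / (1 - c * Q * Q ^ l)))"
    by (intro prod.cong refl) (simp add: algebra_simps)
  also have "\<dots> = Q ^ n * ((\<Prod>l<n. x - c * Q ^ l) / qpoch (c * Q) q n)"
    by (simp only: prod.distrib prod_constant card_lessThan prod_dividef qpoch_def Q_def)
  also have "f n x c = (\<Prod>l<n. x - c * Q ^ l) / qpoch c q n"
    using IH [of c x] Suc.prems by (simp add: prod_dividef qpoch_def Q_def)
  also have "(\<Prod>l<n. x - c * Q ^ l) / qpoch c q n - Q powi (- int n) *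
       ((1 - x) / (1 - c) * (Q ^ n * ((\<Prod>l<n. x - c * Q ^ l) / qpoch (c * Q) q n))) =
      (\<Prod>l<n. x - c * Q ^ l) * (1 / qpoch c q n - (1 - x) / ((1 - c) * qpoch (c * Q) q n))"
    using Q0 by (simp add: power_int_minus divide_simps) (simp add: algebra_simps)
  also have "(1 - c) * qpoch (c * Q) q n = qpoch c q (Suc n)"
    by (simp add: qpoch_Suc_shift Q_def)
  also have "1 / qpoch c q n - (1 - x) / qpoch c q (Suc n) = (x - c * Q ^ n) / qpoch c q (Suc n)"
    using Suc.prems [of "Suc n"] by (simp add: qpoch_Suc Q_def divide_simps)
  also have "(\<Prod>l<n. x - c * Q ^ l) * ((x - c * Q ^ n) / qpoch c q (Suc n)) =
      (\<Prod>l<Suc n. (x - c * Q ^ l) / (1 - c * Q ^ l))"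
    by (simp only: prod_dividef qpoch_def Q_def prod.lessThan_Suc times_divide_eq_right)
  finally show ?case by (simp add: f_def u_def Q_def)
qed simp

text \<open>This is the summation over a single index of the multiple sum, where \<open>K\<close> is the sum of the later
  indices. Splitting \<open>(x; q)\<^sub>k\<^sub>+\<^sub>K\<close> and \<open>(t; q)\<^sub>k\<^sub>+\<^sub>K\<close> at \<open>K\<close> turns it into the
  \<open>q\<close>-Chu--Vandermonde sum with \<open>x\<close> and \<open>t\<close> replaced by \<open>x q\<^sup>K\<close> and \<open>t q\<^sup>K\<close>. The extra factors are
  exactly those that make the product on the right independent of \<open>K\<close>, which is what lets the
  summations decouple.\<close>
lemma q_chu_vandermonde_shifted:
  assumes q: "0 < q" "q < 1" and t: "\<And>k. qpoch t q k \<noteq> 0"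
  shows "(\<Sum>k=0..n. qpoch (of_real q powi (- int n)) q k / (qpoch (of_real q) q k * qpoch t q k) *
            (qpoch (t * of_real q ^ n) q K / qpoch (t * of_real q ^ k) q K) *
            (of_real q ^ k / of_real q ^ (n * K)) * qpoch x q (k + K)) =
         qpoch x q K * (\<Prod>l<n. (x - t * of_real q ^ l) / (1 - t * of_real q ^ l))"
proof -
  define Q where "Q = complex_of_real q"
  have Q0: "Q \<noteq> 0" using q by (simp add: Q_def)
  have tK: "qpoch (t * Q ^ K) q k \<noteq> 0" for k K
    unfolding Q_def using qpoch_shift_nonzero [OF t] .
  have "(\<Sum>k=0..n. qpoch (Q powi (- int n)) q k / (qpoch Q q k * qpoch t q k) *
            (qpoch (t * Q ^ n) q K / qpoch (t * Q ^ k) q K) *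
            (Q ^ k / Q ^ (n * K)) * qpoch x q (k + K)) =
     (\<Sum>k\<le>n. (qpoch (t * Q ^ n) q K / (qpoch t q K * Q ^ (n * K)) * qpoch x q K) *
        (qpoch (Q powi (- int n)) q k / qpoch Q q k * Q ^ k *
            (qpoch (x * Q ^ K) q k / qpoch (t * Q ^ K) q k)))"
  proof (intro sum.cong)
    fix k
    have x: "qpoch x q (k + K) = qpoch x q K * qpoch (x * Q ^ K) q k"
      by (simp add: qpoch_add add.commute [of k] Q_def)
    have "qpoch t q k * qpoch (t * Q ^ k) q K = qpoch t q K * qpoch (t * Q ^ K) q k"
      using qpoch_add [of t q k K] qpoch_add [of t q K k] by (simp add: add.commute Q_def)
    then have "A / (B * qpoch t q k) * (C / qpoch (t * Q ^ k) q K) * (D / E) * (F * G) =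
        C / (qpoch t q K * E) * F * (A / B * D * (G / qpoch (t * Q ^ K) q k))" for A B C D E F G
      by (simp add: mult_ac)
    then show "qpoch (Q powi (- int n)) q k / (qpoch Q q k * qpoch t q k) *
            (qpoch (t * Q ^ n) q K / qpoch (t * Q ^ k) q K) *
            (Q ^ k / Q ^ (n * K)) * qpoch x q (k + K) = (qpoch (t * Q ^ n) q K / (qpoch t q K * Q ^ (n * K)) * qpoch x q K) *
        (qpoch (Q powi (- int n)) q k / qpoch Q q k * Q ^ k *
            (qpoch (x * Q ^ K) q k / qpoch (t * Q ^ K) q k))"
      unfolding x by blast
  qed auto
  also have "\<dots> = (qpoch (t * Q ^ n) q K / (qpoch t q K * Q ^ (n * K)) * qpoch x q K) *
      (\<Prod>l<n. (x * Q ^ K - t * Q ^ K * Q ^ l) / (1 - t * Q ^ K * Q ^ l))"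
    unfolding Q_def sum_distrib_left [symmetric]
    by (subst q_chu_vandermonde [OF q]) (use tK in \<open>simp_all add: Q_def\<close>)
  also have "(\<Prod>l<n. (x * Q ^ K - t * Q ^ K * Q ^ l) / (1 - t * Q ^ K * Q ^ l)) =
      (\<Prod>l<n. Q ^ K * ((x - t * Q ^ l) / (1 - t * Q ^ K * Q ^ l)))"
    by (intro prod.cong refl) (simp add: algebra_simps)
  also have "\<dots> = Q ^ (n * K) * ((\<Prod>l<n. x - t * Q ^ l) / qpoch (t * Q ^ K) q n)"
    by (simp only: prod.distrib prod_constant card_lessThan prod_dividef qpoch_def Q_def power_mult [symmetric] mult.commute [of n])
  also have "qpoch (t * Q ^ n) q K / (qpoch t q K * Q ^ (n * K)) * qpoch x q K *
      (Q ^ (n * K) * ((\<Prod>l<n. x - t * Q ^ l) / qpoch (t * Q ^ K) q n)) =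
      qpoch x q K * (\<Prod>l<n. x - t * Q ^ l) * (qpoch (t * Q ^ n) q K / (qpoch t q K * qpoch (t * Q ^ K) q n))"
    using Q0 by simp
  also have "qpoch t q K * qpoch (t * Q ^ K) q n = qpoch t q n * qpoch (t * Q ^ n) q K"
    using qpoch_add [of t q n K] qpoch_add [of t q K n] by (simp add: add.commute Q_def)
  also have "qpoch (t * Q ^ n) q K / (qpoch t q n * qpoch (t * Q ^ n) q K) = 1 / qpoch t q n"
    using tK by simp
  finally show ?thesis by (simp add: Q_def qpoch_def prod_dividef)
qed

text \<open>The lower index \<open>s\<close> is free so that the indices can be summed out one after the other; the product
  runs up to \<open>r\<close>, where the middle quotient is \<open>1\<close> because its sums are empty.\<close>
definition mlql_coeff :: "nat \<Rightarrow> nat \<Rightarrow> (nat \<Rightarrow> nat) \<Rightarrow> (nat \<Rightarrow> complex) \<Rightarrow> real \<Rightarrow> (nat \<Rightarrow> nat) \<Rightarrow> complex" where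
  "mlql_coeff s r n t q k = (\<Prod>j=s..r.
     qpoch (of_real q powi (- int (n j))) q (k j) / (qpoch (of_real q) q (k j) * qpoch (t j) q (k j)) *
     (qpoch (t j * of_real q ^ n j) q (\<Sum>i=j+1..r. k i) /
      qpoch (t j * of_real q ^ k j) q (\<Sum>i=j+1..r. k i)) *
     (of_real q ^ k j / of_real q ^ (n j * (\<Sum>i=j+1..r. k i))))"

lemma sum_PiE_insert:
  fixes g :: "('a \<Rightarrow> 'b) \<Rightarrow> 'c::comm_monoid_add"
  assumes "x \<notin> S"
  shows "(\<Sum>k\<in>PiE (insert x S) T. g k) = (\<Sum>k\<in>PiE S T. \<Sum>y\<in>T x. g (k(x := y)))"
proof -
  have "(\<Sum>k\<in>PiE (insert x S) T. g k) = (\<Sum>(y, k)\<in>T x \<times> PiE S T. g (k(x := y)))"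
    unfolding PiE_insert_eq
    by (subst sum.reindex [OF inj_combinator [OF assms]]) (simp add: case_prod_unfold o_def)
  also have "\<dots> = (\<Sum>y\<in>T x. \<Sum>k\<in>PiE S T. g (k(x := y)))"
    by (rule sum.cartesian_product [symmetric])
  also have "\<dots> = (\<Sum>k\<in>PiE S T. \<Sum>y\<in>T x. g (k(x := y)))"
    by (rule sum.swap)
  finally show ?thesis .
qed

text \<open>The summand depends on \<open>k s\<close> only through the factor for \<open>j = s\<close> and through the total, so the sum
  over \<open>k s\<close> can be carried out first; what remains has the same shape with \<open>s + 1\<close> in place of \<open>s\<close>.\<close>
lemma multiple_q_chu_vandermonde:
  assumes q: "0 < q" "q < 1" and t: "\<And>j k. j \<in> {s..r} \<Longrightarrow> qpoch (t j) q k \<noteq> 0"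
  shows "(\<Sum>k\<in>PiE {s..r} (\<lambda>j. {0..n j}). mlql_coeff s r n t q k * qpoch x q (\<Sum>j=s..r. k j)) =
         (\<Prod>j=s..r. \<Prod>l<n j. (x - t j * of_real q ^ l) / (1 - t j * of_real q ^ l))"
  using t
proof (induction "Suc r - s" arbitrary: s)
  case 0
  then have "{s..r} = {}" by auto
  then show ?case by (simp add: mlql_coeff_def)
next
  case (Suc d)
  then have s: "s \<le> r" by auto
  have ins: "{s..r} = insert s {Suc s..r}" using s by auto
  have IH: "(\<Sum>k\<in>PiE {Suc s..r} (\<lambda>j. {0..n j}). mlql_coeff (Suc s) r n t q k * qpoch x q (\<Sum>j=Suc s..r. k j)) =
         (\<Prod>j=Suc s..r. \<Prod>l<n j. (x - t j * of_real q ^ l) / (1 - t j * of_real q ^ l))"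
    using Suc by auto
  define h where "h = (\<lambda>K y. qpoch (of_real q powi (- int (n s))) q y / (qpoch (of_real q) q y * qpoch (t s) q y) *
            (qpoch (t s * of_real q ^ n s) q K / qpoch (t s * of_real q ^ y) q K) *
            (of_real q ^ y / of_real q ^ (n s * K)))"
  have coeff: "mlql_coeff s r n t q (k(s := y)) = h (\<Sum>i=Suc s..r. k i) y * mlql_coeff (Suc s) r n t q k" for k y
  proof -
    have *: "(\<Sum>i=j+1..r. (k(s := y)) i) = (\<Sum>i=j+1..r. k i)" if "j \<ge> s" for j
      using that by (intro sum.cong) auto
    have "mlql_coeff s r n t q (k(s := y)) = h (\<Sum>i=Suc s..r. k i) y * 
      (\<Prod>j=Suc s..r.
     qpoch (of_real q powi (- int (n j))) q ((k(s := y)) j) / (qpoch (of_real q) q ((k(s := y)) j) * qpoch (t j) q ((k(s := y)) j)) *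
     (qpoch (t j * of_real q ^ n j) q (\<Sum>i=j+1..r. (k(s := y)) i) /
      qpoch (t j * of_real q ^ (k(s := y)) j) q (\<Sum>i=j+1..r. (k(s := y)) i)) *
     (of_real q ^ (k(s := y)) j / of_real q ^ (n j * (\<Sum>i=j+1..r. (k(s := y)) i))))"
      unfolding mlql_coeff_def ins h_def using *[of s] by simp
    also have "\<dots> = h (\<Sum>i=Suc s..r. k i) y * mlql_coeff (Suc s) r n t q k"
      unfolding mlql_coeff_def using *
      by (intro arg_cong2 [where f = "(*)"] refl prod.cong) auto
    finally show ?thesis .
  qed
  have tot: "(\<Sum>j=s..r. (k(s := y)) j) = y + (\<Sum>j=Suc s..r. k j)" for k :: "nat \<Rightarrow> nat" and y
    unfolding ins by (subst sum.insert) (auto intro!: sum.cong)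
  have step: "(\<Sum>y=0..n s. h K y * qpoch x q (y + K)) =
      qpoch x q K * (\<Prod>l<n s. (x - t s * of_real q ^ l) / (1 - t s * of_real q ^ l))" for K
    unfolding h_def using Suc.prems [of s] s by (intro q_chu_vandermonde_shifted [OF q]) auto
  have "(\<Sum>k\<in>PiE {s..r} (\<lambda>j. {0..n j}). mlql_coeff s r n t q k * qpoch x q (\<Sum>j=s..r. k j)) =
     (\<Sum>k\<in>PiE {Suc s..r} (\<lambda>j. {0..n j}). \<Sum>y=0..n s.
        mlql_coeff s r n t q (k(s := y)) * qpoch x q (\<Sum>j=s..r. (k(s := y)) j))"
    by (subst ins, subst sum_PiE_insert) auto
  also have "\<dots> = (\<Sum>k\<in>PiE {Suc s..r} (\<lambda>j. {0..n j}). mlql_coeff (Suc s) r n t q k *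
        (\<Sum>y=0..n s. h (\<Sum>i=Suc s..r. k i) y * qpoch x q (y + (\<Sum>j=Suc s..r. k j))))"
    unfolding coeff tot sum_distrib_left by (intro sum.cong refl) (simp add: mult_ac)
  also have "\<dots> = (\<Sum>k\<in>PiE {Suc s..r} (\<lambda>j. {0..n j}). mlql_coeff (Suc s) r n t q k * qpoch x q (\<Sum>j=Suc s..r. k j)) *
       (\<Prod>l<n s. (x - t s * of_real q ^ l) / (1 - t s * of_real q ^ l))"
    unfolding step by (simp add: sum_distrib_right mult.assoc)
  also have "\<dots> = (\<Prod>j=s..r. \<Prod>l<n j. (x - t j * of_real q ^ l) / (1 - t j * of_real q ^ l))"
    unfolding IH ins by simp
  finally show ?case .
qed

section \<open>Linear maps given by a graded basis of the polynomials\<close>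

text \<open>The linear map with \<open>x ^ k \<mapsto> B k\<close>. It covers both \<open>asc_T\<close> and the map to the basis
  \<open>(x; q)\<^sub>k\<close>.\<close>
definition basis_map :: "(nat \<Rightarrow> complex poly) \<Rightarrow> complex poly \<Rightarrow> complex poly" where
  "basis_map B p = (\<Sum>k\<le>degree p. smult (coeff p k) (B k))"

lemma basis_map_upto:
  assumes "degree p \<le> N"
  shows "basis_map B p = (\<Sum>k\<le>N. smult (coeff p k) (B k))"
  unfolding basis_map_def using assms
  by (intro sum.mono_neutral_left) (auto simp: coeff_eq_0)

lemma basis_map_0 [simp]: "basis_map B 0 = 0"
  by (simp add: basis_map_def)

lemma basis_map_add: "basis_map B (p + s) = basis_map B p + basis_map B s"
  using basis_map_upto [of p "max (degree p) (degree s)" B]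
    basis_map_upto [of s "max (degree p) (degree s)" B]
    basis_map_upto [of "p + s" "max (degree p) (degree s)" B]
  by (simp add: degree_add_le smult_add_left sum.distrib)

lemma basis_map_diff: "basis_map B (p - s) = basis_map B p - basis_map B s"
  using basis_map_add [of B "p - s" s] by simp

lemma basis_map_sum: "basis_map B (\<Sum>i\<in>I. f i) = (\<Sum>i\<in>I. basis_map B (f i))"
  by (induction I rule: infinite_finite_induct) (simp_all add: basis_map_add)

lemma basis_map_monom: "basis_map B (monom c k) = smult c (B k)"
proof -
  have "basis_map B (monom c k) = (\<Sum>i\<le>k. if i = k then smult c (B i) else 0)"
    unfolding basis_map_upto [OF degree_monom_le] by (intro sum.cong) auto
  then show ?thesis by simp
qed

context
  fixes B :: "nat \<Rightarrow> complex poly"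
  assumes degB: "\<And>k. degree (B k) = k" and B0: "B 0 \<noteq> 0"
begin

text \<open>The matrix of the map is triangular with nonzero diagonal, so the map preserves degrees and is
  bijective.\<close>
lemma coeff_basis_map_degree:
  "coeff (basis_map B p) (degree p) = lead_coeff p * lead_coeff (B (degree p))"
proof -
  have "coeff (basis_map B p) (degree p) =
      (\<Sum>k\<le>degree p. if k = degree p then coeff p k * coeff (B k) (degree p) else 0)"
    unfolding basis_map_def coeff_sum using degB
    by (intro sum.cong) (auto simp: coeff_eq_0)
  then show ?thesis using degB by simp
qed

lemma basis_nonzero: "B k \<noteq> 0"
  using degB [of k] B0 by (cases k) auto

lemma degree_basis_map: "degree (basis_map B p) = degree p"
proof (cases "p = 0")
  case False
  have "degree (basis_map B p) \<le> degree p"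
    unfolding basis_map_def using degB
    by (intro degree_sum_le) (auto intro: order.trans [OF degree_smult_le])
  moreover have "degree p \<le> degree (basis_map B p)"
    using False basis_nonzero by (intro le_degree) (simp add: coeff_basis_map_degree)
  ultimately show ?thesis by simp
qed simp

lemma basis_map_eq_0_iff: "basis_map B p = 0 \<longleftrightarrow> p = 0"
  using coeff_basis_map_degree [of p] basis_nonzero by (cases "p = 0") auto

lemma basis_map_surj: "\<exists>p. basis_map B p = g"
proof (induction "degree g" arbitrary: g rule: less_induct)
  case less
  define c where "c = lead_coeff g / lead_coeff (B (degree g))"
  define g' where "g' = g - smult c (B (degree g))"
  have deg: "degree g' \<le> degree g"
    unfolding g'_def using degB by (intro degree_diff_le order.trans [OF degree_smult_le]) auto
  have cf: "coeff g' (degree g) = 0"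
    using basis_nonzero [of "degree g"] degB [of "degree g"] leading_coeff_0_iff [of "B (degree g)"]
    by (simp add: g'_def c_def)
  have "\<exists>p. basis_map B p = g'"
  proof (cases "degree g' < degree g")
    case False
    with deg cf have "g' = 0" by (metis le_neq_implies_less leading_coeff_0_iff)
    then show ?thesis by (intro exI [of _ 0]) simp
  qed (use less in auto)
  then obtain p where "basis_map B p = g'" ..
  then have "basis_map B (p + monom c (degree g)) = g"
    by (simp add: basis_map_add basis_map_monom g'_def)
  then show ?case ..
qed

end

lemma asc_T_eq_basis_map: "asc_T b q = basis_map (asc_basis b q)"
  by (simp add: fun_eq_iff asc_T_def basis_map_def)

lemma asc_basis_0 [simp]: "asc_basis b q 0 = 1"
  by (simp add: asc_basis_def)

lemma degree_asc_basis:
  assumes "b \<noteq> 0" "q \<noteq> 0"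
  shows "degree (asc_basis b q k) = k"
  unfolding asc_basis_def using assms by (subst degree_prod_eq_sum_degree) auto

definition qpoch_poly :: "real \<Rightarrow> nat \<Rightarrow> complex poly" where
  "qpoch_poly q k = (\<Prod>j<k. [:1, - (of_real q ^ j):])"

lemma poly_qpoch_poly [simp]: "poly (qpoch_poly q k) x = qpoch x q k"
  by (simp add: qpoch_poly_def poly_prod qpoch_def)

lemma qpoch_poly_0 [simp]: "qpoch_poly q 0 = 1"
  by (simp add: qpoch_poly_def)

lemma degree_qpoch_poly:
  assumes "q \<noteq> 0"
  shows "degree (qpoch_poly q k) = k"
  unfolding qpoch_poly_def using assms by (subst degree_prod_eq_sum_degree) auto

text \<open>At \<open>1\<close> all \<open>(x; q)\<^sub>k\<close> with \<open>k > 0\<close> vanish. This turns the normalisation at \<open>0\<close> into a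
  normalisation at \<open>1\<close> of the image.\<close>
lemma poly_basis_map_qpoch_poly_1: "poly (basis_map (qpoch_poly q) p) 1 = poly p 0"
proof -
  have "qpoch 1 q k = (if k = 0 then 1 else 0)" for k
    by (cases k) (simp_all add: qpoch_Suc_shift)
  then show ?thesis
    by (simp add: basis_map_def poly_sum poly_0_coeff_0 if_distrib [of "(*) _"] cong: if_cong)
qed

section \<open>Moments of the little q-Laguerre weight\<close>

text \<open>The total mass of the weight \<open>t ^ k / (q; q)\<^sub>k\<close>. Its closed form \<open>1 / (t; q)\<^sub>\<infinity>\<close> is replaced below by
  the functional equation in \<open>t\<close>.\<close>
definition q_exponential :: "real \<Rightarrow> complex \<Rightarrow> complex" where
  "q_exponential q t = (\<Sum>k. t ^ k / qpoch (of_real q) q k)"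

lemma summable_q_exponential:
  assumes q: "0 < q" "q < 1" and t: "norm t < 1"
  shows "summable (\<lambda>k. t ^ k / qpoch (of_real q) q k)"
proof (cases "t = 0")
  case False
  have nz: "qpoch (of_real q) q k \<noteq> 0" for k
    using qpoch_nonzero [of "of_real q" q k] q by simp
  have nz1: "1 - of_real q * of_real q ^ k \<noteq> (0::complex)" for k
    using one_minus_times_power_nonzero [of "of_real q" q k] q by simp
  define u where "u = (\<lambda>k. t ^ k / qpoch (of_real q) q k)"
  have ratio: "norm (u (Suc k)) = norm t / norm (1 - of_real q * of_real q ^ k :: complex) * norm (u k)" for k
    by (simp add: u_def qpoch_Suc norm_mult norm_divide norm_power)
  have lim: "(\<lambda>k. norm t / norm (1 - of_real q * of_real q ^ k :: complex)) \<longlonglongrightarrow> norm t / norm (1 - of_real q * 0 :: complex)"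
    using q by (intro tendsto_intros LIMSEQ_power_zero) auto
  obtain c where c: "norm t < c" "c < 1" using t dense by blast
  have "eventually (\<lambda>k. norm t / norm (1 - of_real q * of_real q ^ k :: complex) < c) sequentially"
    using order_tendstoD(2) [OF lim, of c] c by simp
  then obtain N where N: "\<And>k. k \<ge> N \<Longrightarrow> norm t / norm (1 - of_real q * of_real q ^ k :: complex) < c"
    by (auto simp: eventually_sequentially)
  have "summable u"
  proof (rule summable_ratio_test [OF c(2)])
    fix k assume "k \<ge> N"
    then show "norm (u (Suc k)) \<le> c * norm (u k)"
      unfolding ratio using N [of k] by (intro mult_right_mono) auto
  qed
  then show ?thesis by (simp add: u_def)
next
  case True
  then show ?thesis by (intro summable_finite [of "{0}"]) auto
qed

text \<open>The coefficients of \<open>e(t) - e(t q)\<close> are \<open>(1 - q\<^sup>k) / (q; q)\<^sub>k = 1 / (q; q)\<^sub>k\<^sub>-\<^sub>1\<close>, so this difference is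
  \<open>t e(t)\<close>.\<close>
lemma q_exponential_shift:
  assumes q: "0 < q" "q < 1" and t: "norm t < 1"
  shows "q_exponential q (t * of_real q) = (1 - t) * q_exponential q t"
proof -
  have tq: "norm (t * of_real q) < 1"
    using mult_strict_mono' [of "norm t" 1 q 1] q t by (simp add: norm_mult)
  have nz: "qpoch (of_real q) q k \<noteq> 0" for k
    using qpoch_nonzero [of "of_real q" q k] q by simp
  note S = summable_q_exponential [OF q t] and Sq = summable_q_exponential [OF q tq]
  define d where "d = (\<lambda>k. t ^ k / qpoch (of_real q) q k - (t * of_real q) ^ k / qpoch (of_real q) q k)"
  have "d (Suc k) = t * (t ^ k / qpoch (of_real q) q k)" for k
  proof -
    have nz': "1 - of_real q * of_real q ^ k \<noteq> (0::complex)"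
      using one_minus_times_power_nonzero [of "of_real q" q k] q by simp
    have "d (Suc k) = t ^ Suc k * (1 - of_real q * of_real q ^ k) / (qpoch (of_real q) q k * (1 - of_real q * of_real q ^ k))"
      by (simp add: d_def qpoch_Suc power_mult_distrib diff_divide_distrib [symmetric] algebra_simps)
    then show ?thesis using nz' by simp
  qed
  then have "(\<Sum>k. d (Suc k)) = t * q_exponential q t"
    using suminf_mult [OF S, of t] by (simp add: q_exponential_def)
  moreover have "summable d" unfolding d_def by (intro summable_diff S Sq)
  moreover have "d 0 = 0" by (simp add: d_def)
  ultimately have "suminf d = t * q_exponential q t"
    using suminf_split_head [of d] by simp
  moreover have "suminf d = q_exponential q t - q_exponential q (t * of_real q)"
    unfolding d_def q_exponential_def by (rule suminf_diff [OF S Sq, symmetric])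
  ultimately show ?thesis by (simp add: algebra_simps)
qed

lemma norm_times_power_less_1:
  assumes q: "0 < q" "q < 1" and t: "norm (t::complex) < 1"
  shows "norm (t * of_real q ^ m) < 1"
proof -
  have "norm t * q ^ m \<le> norm t * 1"
    using q by (intro mult_left_mono power_le_one) auto
  then show ?thesis using q t by (simp add: norm_mult norm_power)
qed

lemma q_exponential_shift_power:
  assumes q: "0 < q" "q < 1" and t: "norm t < 1"
  shows "q_exponential q (t * of_real q ^ m) = qpoch t q m * q_exponential q t"
proof (induction m)
  case (Suc m)
  then show ?case
    using q_exponential_shift [OF q norm_times_power_less_1 [OF q t], of m]
    by (simp add: qpoch_Suc mult_ac)
qed simp

text \<open>A zero at \<open>t\<close> would propagate to all \<open>t q\<^sup>m\<close>, and hence by continuity to \<open>0\<close>, where the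
  value is \<open>1\<close>.\<close>
lemma q_exponential_nonzero:
  assumes q: "0 < q" "q < 1" and t: "norm t < 1"
  shows "q_exponential q t \<noteq> 0"
proof
  assume 0: "q_exponential q t = 0"
  have "isCont (\<lambda>x. \<Sum>k. (1 / qpoch (of_real q) q k) * x ^ k) (0::complex)"
    by (rule isCont_powser [where K = "1 / 2"])
       (use summable_q_exponential [OF q, of "1 / 2"] in \<open>simp_all\<close>)
  then have "isCont (q_exponential q) 0"
    by (simp add: q_exponential_def [abs_def])
  moreover have "(\<lambda>m. t * of_real q ^ m) \<longlonglongrightarrow> t * 0"
    using q by (intro tendsto_intros LIMSEQ_power_zero) auto
  ultimately have "(\<lambda>m. q_exponential q (t * of_real q ^ m)) \<longlonglongrightarrow> q_exponential q 0"
    by (auto intro: isCont_tendsto_compose)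
  then have "q_exponential q 0 = 0"
    by (simp add: q_exponential_shift_power [OF q t] 0 LIMSEQ_const_iff)
  moreover have "q_exponential q 0 = 1"
    unfolding q_exponential_def by (subst suminf_finite [of "{0}"]) auto
  ultimately show False by simp
qed

text \<open>Multiplying the weight by \<open>(q\<^sup>k)\<^sup>m\<close> replaces its parameter \<open>t\<close> by \<open>t q\<^sup>m\<close>, so the monomial \<open>x ^ m\<close>
  contributes \<open>(t; q)\<^sub>l\<^sub>+\<^sub>m e(t) = (t; q)\<^sub>l (t q\<^sup>l; q)\<^sub>m e(t)\<close>.\<close>
lemma little_q_laguerre_moment:
  assumes q: "0 < q" "q < 1" and t: "norm t < 1"
  shows "(\<lambda>k. poly p (of_real q ^ k) * of_real q ^ (k * l) * (t ^ k / qpoch (of_real q) q k)) sums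
           (q_exponential q t * qpoch t q l * poly (basis_map (qpoch_poly q) p) (t * of_real q ^ l))"
proof -
  define Q where "Q = complex_of_real q"
  have "(\<lambda>k. \<Sum>m\<le>degree p. coeff p m * ((t * Q ^ (l + m)) ^ k / qpoch Q q k)) sums
      (\<Sum>m\<le>degree p. coeff p m * q_exponential q (t * Q ^ (l + m)))"
    unfolding q_exponential_def Q_def
    by (intro sums_sum sums_mult summable_sums summable_q_exponential norm_times_power_less_1 q t)
  also have "(\<lambda>k. \<Sum>m\<le>degree p. coeff p m * ((t * Q ^ (l + m)) ^ k / qpoch Q q k)) =
      (\<lambda>k. poly p (Q ^ k) * Q ^ (k * l) * (t ^ k / qpoch Q q k))"
    unfolding poly_altdef sum_distrib_right
    by (intro ext sum.cong refl)
       (simp add: power_mult_distrib power_add power_mult [symmetric] mult_ac)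
  also have "(\<Sum>m\<le>degree p. coeff p m * q_exponential q (t * Q ^ (l + m))) =
      q_exponential q t * qpoch t q l * poly (basis_map (qpoch_poly q) p) (t * Q ^ l)"
    unfolding basis_map_def poly_sum sum_distrib_left Q_def q_exponential_shift_power [OF q t]
    by (intro sum.cong refl) (simp add: qpoch_add)
  finally show ?thesis by (simp add: Q_def)
qed

section \<open>Infinite q-shifted factorials\<close>

lemma convergent_prod_qpoch_inf:
  assumes q: "0 < q" "q < 1"
  shows "convergent_prod (\<lambda>j. 1 - z * of_real q ^ j :: complex)"
proof -
  have "summable (\<lambda>j. norm z * q ^ j)"
    using q by (intro summable_mult summable_geometric) auto
  then show ?thesis
    using q by (intro abs_convergent_prod_imp_convergent_prod)
      (simp add: abs_convergent_prod_conv_summable norm_mult norm_power)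
qed

lemma qpoch_inf_split:
  assumes q: "0 < q" "q < 1"
  shows "qpoch_inf z q = qpoch z q k * qpoch_inf (z * of_real q ^ k) q"
proof -
  have "(\<lambda>j. 1 - z * of_real q ^ j) has_prod
      ((\<Prod>j<k. 1 - z * of_real q ^ j) * (\<Prod>j. 1 - z * of_real q ^ (j + k)))"
    by (rule has_prod_ignore_initial_segment' [OF convergent_prod_qpoch_inf [OF q]])
  from has_prod_unique [OF this] show ?thesis
    by (simp add: qpoch_inf_def qpoch_def power_add mult_ac)
qed

lemma qpoch_inf_step:
  assumes q: "0 < q" "q < 1"
  shows "qpoch_inf z q = (1 - z) * qpoch_inf (z * of_real q) q"
  using qpoch_inf_split [OF q, of z 1] by (simp add: qpoch_Suc)

lemma qpoch_inf_nonzero: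
  assumes q: "0 < q" "q < 1" and z: "norm z < 1"
  shows "qpoch_inf z q \<noteq> 0"
  unfolding qpoch_inf_def
  by (intro prodinf_nonzero convergent_prod_qpoch_inf one_minus_times_power_nonzero q z)

lemma holomorphic_qpoch_inf:
  assumes q: "0 < q" "q < 1"
  shows "(\<lambda>z. qpoch_inf z q) holomorphic_on UNIV"
proof (rule holomorphic_uniform_sequence)
  show "(\<lambda>z. \<Prod>j<n. 1 - z * of_real q ^ j) holomorphic_on UNIV" for n
    by (intro holomorphic_intros)
next
  fix x :: complex
  define A where "A = cball x 1"
  have "uniformly_convergent_on A (\<lambda>N z. \<Sum>j<N. norm (1 - z * of_real q ^ j - 1))"
  proof (rule Weierstrass_m_test' [where M = "\<lambda>j. (norm x + 1) * q ^ j"])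
    fix j z assume "z \<in> A"
    then have "norm z \<le> norm x + 1"
      using norm_triangle_ineq2 [of z x] by (simp add: A_def dist_norm norm_minus_commute)
    then show "norm (norm (1 - z * of_real q ^ j - 1)) \<le> (norm x + 1) * q ^ j"
      using q by (simp add: norm_mult norm_power mult_right_mono)
  next
    show "summable (\<lambda>j. (norm x + 1) * q ^ j)"
      using q by (intro summable_mult summable_geometric) auto
  qed
  then have "uniformly_convergent_on A (\<lambda>N z. \<Prod>j<N. 1 - z * of_real q ^ j)"
    by (intro uniformly_convergent_on_prod') (auto simp: A_def intro!: continuous_intros)
  then have "uniform_limit A (\<lambda>N z. \<Prod>j<N. 1 - z * of_real q ^ j)
      (\<lambda>z. lim (\<lambda>N. \<Prod>j<N. 1 - z * of_real q ^ j)) sequentially"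
    by (simp add: uniformly_convergent_uniform_limit_iff)
  moreover have "lim (\<lambda>N. \<Prod>j<N. 1 - z * of_real q ^ j) = qpoch_inf z q" for z
    unfolding qpoch_inf_def
    using convergent_prod_LIMSEQ [OF convergent_prod_qpoch_inf [OF q, of z]]
    by (intro limI) (simp add: LIMSEQ_lessThan_iff_atMost)
  ultimately have "uniform_limit A (\<lambda>N z. \<Prod>j<N. 1 - z * of_real q ^ j) (\<lambda>z. qpoch_inf z q) sequentially"
    by simp
  then show "\<exists>d>0. cball x d \<subseteq> UNIV \<and> uniform_limit (cball x d)
      (\<lambda>N z. \<Prod>j<N. 1 - z * of_real q ^ j) (\<lambda>z. qpoch_inf z q) sequentially"
    unfolding A_def by (intro exI [of _ 1]) auto
qed simp

lemma holomorphic_on_qpoch_inf [holomorphic_intros]: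
  assumes "0 < q" "q < 1" "f holomorphic_on A"
  shows "(\<lambda>z. qpoch_inf (f z) q) holomorphic_on A"
  using holomorphic_on_compose_gen [OF assms(3) holomorphic_qpoch_inf [OF assms(1,2)]]
  by (simp add: o_def)

lemma continuous_on_qpoch_inf [continuous_intros]:
  assumes "0 < q" "q < 1" "continuous_on A f"
  shows "continuous_on A (\<lambda>z. qpoch_inf (f z) q)"
  using continuous_on_compose2 [OF holomorphic_on_imp_continuous_on [OF holomorphic_qpoch_inf [OF assms(1,2)]] assms(3)]
  by simp

section \<open>The total mass of the Al-Salam--Chihara weight\<close>

text \<open>The two means are, up to the factor \<open>\<i>\<close>, contour integrals of \<open>f z / z\<close> over homotopic circles.\<close>
lemma circle_mean_eq:
  assumes S: "open S" and f: "f holomorphic_on S" and r: "0 < r1" "r1 \<le> r2"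
    and sub: "{z. r1 \<le> norm z \<and> norm z \<le> r2} \<subseteq> S"
  shows "integral {-pi..pi} (\<lambda>t. f (of_real r1 * cis t)) = integral {-pi..pi} (\<lambda>t. f (of_real r2 * cis t))"
proof -
  define h where "h = (\<lambda>z. f z / z)"
  define S' where "S' = S - {0}"
  define C where "C = (\<lambda>r. part_circlepath 0 r (-pi) pi)"
  have S': "open S'" unfolding S'_def using S by (intro open_delete)
  have h: "h holomorphic_on S'"
    unfolding h_def S'_def by (intro holomorphic_intros holomorphic_on_subset [OF f]) auto
  have C: "path (C r)" "valid_path (C r)" "pathfinish (C r) = pathstart (C r)" for r
    by (simp_all add: C_def exp_minus)
  have Ceq: "C r t = of_real r * cis (linepath (-pi) pi t)" for r t
    by (simp add: C_def part_circlepath_def cis_conv_exp of_real_linepath [symmetric])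
  have in_S': "of_real r * cis s \<in> S'" if "r1 \<le> r" "r \<le> r2" for r s
    using that r sub by (auto simp: S'_def norm_mult)
  have img: "path_image (C r) \<subseteq> S'" if "r1 \<le> r" "r \<le> r2" for r
    using in_S' [OF that] by (auto simp: path_image_def Ceq)
  have "homotopic_loops S' (C r1) (C r2)"
  proof (rule homotopic_loops_linear)
    fix t x
    show "closed_segment (C r1 t) (C r2 t) \<subseteq> S'"
    proof
      fix z assume "z \<in> closed_segment (C r1 t) (C r2 t)"
      then obtain u where u: "0 \<le> u" "u \<le> 1" and "z = (1 - u) *\<^sub>R C r1 t + u *\<^sub>R C r2 t"
        by (auto simp: closed_segment_def)
      then have "z = of_real ((1 - u) * r1 + u * r2) * cis (linepath (-pi) pi t)"
        by (simp add: Ceq scaleR_conv_of_real algebra_simps)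
      moreover have "r1 \<le> (1 - u) * r1 + u * r2" 
        using mult_left_mono [OF r(2) u(1)] by (simp add: algebra_simps)
      moreover have "(1 - u) * r1 + u * r2 \<le> r2" 
        using mult_left_mono [OF r(2), of "1 - u"] u by (simp add: algebra_simps)
      ultimately show "z \<in> S'" using in_S' by metis
    qed
  qed (rule C)+
  then have "contour_integral (C r1) h = contour_integral (C r2) h"
    by (rule Cauchy_theorem_homotopic_loops [OF _ S' h C(2) C(2)])
  moreover have "contour_integral (C r) h = \<i> * integral {-pi..pi} (\<lambda>t. f (of_real r * cis t))"
    if r': "r1 \<le> r" "r \<le> r2" for r
  proof -
    have "h contour_integrable_on C r"
      by (rule contour_integrable_holomorphic_simple [OF h S' C(2) img [OF r']])
    then have "(h has_contour_integral contour_integral (C r) h) (C r)"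
      by (rule has_contour_integral_integral)
    then have "((\<lambda>t. h (0 + of_real r * cis t) * of_real r * \<i> * cis t) has_integral contour_integral (C r) h) {-pi..pi}"
      unfolding C_def by (subst (asm) has_contour_integral_part_circlepath_iff) auto
    then have "((\<lambda>t. \<i> * f (of_real r * cis t)) has_integral contour_integral (C r) h) {-pi..pi}"
      using r r' by (simp add: h_def mult_ac)
    from Henstock_Kurzweil_Integration.integral_unique [OF this] show ?thesis by simp
  qed
  ultimately show ?thesis using r by simp
qed

text \<open>The weight as a function of \<open>z = e\<^sup>i\<^sup>\<theta>\<close>, which makes sense off the unit circle.\<close>
definition asc_symbol :: "real \<Rightarrow> complex \<Rightarrow> complex \<Rightarrow> complex \<Rightarrow> complex" where
  "asc_symbol q a b z = qpoch_inf (z\<^sup>2) q * qpoch_inf (1 / z\<^sup>2) q /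
     (qpoch_inf (a * z) q * qpoch_inf (a / z) q * qpoch_inf (b * z) q * qpoch_inf (b / z) q)"

lemma asc_weight_eq_symbol: "asc_weight \<theta> a b q = asc_symbol q a b (cis \<theta>)"
proof -
  have "cis (2 * \<theta>) = (cis \<theta>)\<^sup>2" "cis (- 2 * \<theta>) = 1 / (cis \<theta>)\<^sup>2" "cis (- \<theta>) = 1 / cis \<theta>"
    by (simp_all add: power2_eq_square cis_mult eq_divide_eq)
  then show ?thesis by (simp add: asc_weight_def asc_symbol_def)
qed

text \<open>An antidifference under \<open>z \<mapsto> z / q\<close> of the weight times \<open>2 cos \<theta> - a - b\<close>. Up to a constant and
  the substitution \<open>z \<mapsto> q\<^sup>1\<^sup>/\<^sup>2 z\<close>, it is the weight with parameters \<open>q\<^sup>1\<^sup>/\<^sup>2 a\<close> and \<open>q\<^sup>1\<^sup>/\<^sup>2 b\<close>,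
  divided by \<open>z - 1 / z\<close>, as in the Rodrigues formula for the polynomial of degree one. The division
  has been carried out by cancelling \<open>1 - z\<^sup>-\<^sup>2\<close> against the first factor of \<open>(z\<^sup>-\<^sup>2; q)\<^sub>\<infinity>\<close>, so that the
  divisor leaves no singularities.\<close>
definition asc_primitive :: "real \<Rightarrow> complex \<Rightarrow> complex \<Rightarrow> complex \<Rightarrow> complex" where
  "asc_primitive q a b z = qpoch_inf (of_real q * z\<^sup>2) q * qpoch_inf (1 / z\<^sup>2) q /
     (z * (qpoch_inf (of_real q * a * z) q * qpoch_inf (a / z) q *
           qpoch_inf (of_real q * b * z) q * qpoch_inf (b / z) q))"

text \<open>What remains of the difference equation below after the common infinite products are divided
  out.\<close>
lemma asc_primitive_rational_identity:
  fixes a b z Q :: complex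
  assumes "z \<noteq> 0" "Q \<noteq> 0" "1 - a * z \<noteq> 0" "1 - a / z \<noteq> 0" "1 - b * z \<noteq> 0" "1 - b / z \<noteq> 0"
  shows "(1 - 1 / z\<^sup>2) * (1 - Q / z\<^sup>2) / (z * ((1 - a / z) * (1 - b / z))) -
         (1 - z\<^sup>2 / Q) * (1 - z\<^sup>2) * Q / (z * ((1 - a * z) * (1 - b * z))) =
         (1 - z\<^sup>2) * (1 - 1 / z\<^sup>2) * (1 - Q / z\<^sup>2) /
           ((1 - a * z) * (1 - a / z) * (1 - b * z) * (1 - b / z)) * (z + 1 / z - a - b)"
proof -
  define c where "c = (1 - 1 / z\<^sup>2) * (1 - Q / z\<^sup>2)"
  have nz: "(1 - a * z) * (1 - b * z) \<noteq> 0" "(1 - a / z) * (1 - b / z) \<noteq> 0" using assms by auto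
  have c: "(1 - z\<^sup>2 / Q) * (1 - z\<^sup>2) * Q = z ^ 4 * c"
    using assms(1,2) by (simp add: c_def field_simps power2_eq_square power4_eq_xxxx)
  have main: "(1 - a * z) * (1 - b * z) - z ^ 4 * ((1 - a / z) * (1 - b / z)) =
      z * ((1 - z\<^sup>2) * (z + 1 / z - a - b))"
    using assms(1) by (simp add: field_simps power2_eq_square power4_eq_xxxx)
  have "c / (z * ((1 - a / z) * (1 - b / z))) - z ^ 4 * c / (z * ((1 - a * z) * (1 - b * z))) =
      c * ((1 - a * z) * (1 - b * z) - z ^ 4 * ((1 - a / z) * (1 - b / z))) /
        (z * ((1 - a * z) * (1 - b * z)) * ((1 - a / z) * (1 - b / z)))"
  proof -
    have "c / (z * y) - z ^ 4 * c / (z * x) = c * (x - z ^ 4 * y) / (z * x * y)"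
      if "x \<noteq> 0" "y \<noteq> 0" for x y
      using that assms(1) by (simp add: field_simps)
    from this [OF nz] show ?thesis .
  qed
  also have "\<dots> = c * ((1 - z\<^sup>2) * (z + 1 / z - a - b)) /
        (((1 - a * z) * (1 - b * z)) * ((1 - a / z) * (1 - b / z)))"
    unfolding main using assms(1) by (simp only: mult.left_commute [of c z] mult.assoc [of z]) simp
  also have "\<dots> = (1 - z\<^sup>2) * c /
           ((1 - a * z) * (1 - a / z) * (1 - b * z) * (1 - b / z)) * (z + 1 / z - a - b)"
    by (simp add: mult_ac)
  finally show ?thesis unfolding c by (simp add: c_def mult.assoc)
qed

text \<open>Replacing \<open>z\<close> by \<open>z / q\<close> shifts each infinite product by finitely many factors, so all three terms
  are rational multiples of the same quotient of infinite products.\<close>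
lemma asc_primitive_diff:
  assumes q: "0 < q" "q < 1" and ab: "norm a < 1" "norm b < 1" and z: "norm z = 1"
  shows "asc_primitive q a b z - asc_primitive q a b (z / of_real q) =
           asc_symbol q a b z * (z + 1 / z - a - b)"
proof -
  define Q where "Q = complex_of_real q"
  have z0: "z \<noteq> 0" and Q0: "Q \<noteq> 0" using z q by (auto simp: Q_def)
  \<comment> \<open>the infinite products shared by all three terms\<close>
  define N where "N = qpoch_inf (Q * z\<^sup>2) q * qpoch_inf (Q\<^sup>2 / z\<^sup>2) q"
  define D where "D = qpoch_inf (Q * a * z) q * qpoch_inf (Q * a / z) q *
      qpoch_inf (Q * b * z) q * qpoch_inf (Q * b / z) q"
  note step = qpoch_inf_step [OF q, folded Q_def]
  have lt1: "norm (c * z) < 1" "norm (c / z) < 1" if "norm c < 1" for c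
    using that z by (simp_all add: norm_mult norm_divide)
  have nz: "1 - c * z \<noteq> 0" "1 - c / z \<noteq> 0" if "norm c < 1" for c
    using lt1 [OF that] by (auto simp del: norm_mult norm_divide)
  note nza = nz [OF ab(1)] and nzb = nz [OF ab(2)]
  have s1: "qpoch_inf (z\<^sup>2) q = (1 - z\<^sup>2) * qpoch_inf (Q * z\<^sup>2) q"
    using step [of "z\<^sup>2"] by (simp add: mult.commute)
  have s2: "qpoch_inf (1 / z\<^sup>2) q = (1 - 1 / z\<^sup>2) * (1 - Q / z\<^sup>2) * qpoch_inf (Q\<^sup>2 / z\<^sup>2) q"
    using step [of "1 / z\<^sup>2"] step [of "Q / z\<^sup>2"] by (simp add: power2_eq_square mult.assoc)
  have s3: "qpoch_inf (Q * (z / Q)\<^sup>2) q = (1 - z\<^sup>2 / Q) * (1 - z\<^sup>2) * qpoch_inf (Q * z\<^sup>2) q"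
    using step [of "z\<^sup>2 / Q"] s1 Q0 by (simp add: power2_eq_square mult.assoc)
  have s4: "qpoch_inf (1 / (z / Q)\<^sup>2) q = qpoch_inf (Q\<^sup>2 / z\<^sup>2) q"
    by (simp add: power_divide)
  have s5: "qpoch_inf (c * z) q = (1 - c * z) * qpoch_inf (Q * c * z) q"
    "qpoch_inf (c / z) q = (1 - c / z) * qpoch_inf (Q * c / z) q" for c
    using step [of "c * z"] step [of "c / z"] by (simp_all add: mult_ac)
  have s6: "Q * c * (z / Q) = c * z" "c / (z / Q) = Q * c / z" for c
    using Q0 by (simp_all add: mult.commute)
  have G1: "asc_primitive q a b z = N / D *
      ((1 - 1 / z\<^sup>2) * (1 - Q / z\<^sup>2) / (z * ((1 - a / z) * (1 - b / z))))"
    unfolding asc_primitive_def Q_def [symmetric] s2 s5(2) [of a] s5(2) [of b] N_def D_def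
    by (simp add: mult_ac)
  have G2: "asc_primitive q a b (z / Q) = N / D *
      ((1 - z\<^sup>2 / Q) * (1 - z\<^sup>2) * Q / (z * ((1 - a * z) * (1 - b * z))))"
    unfolding asc_primitive_def Q_def [symmetric] s3 s4 s6 s5(1) [of a] s5(1) [of b] N_def D_def
    by (simp add: mult_ac)
  have W: "asc_symbol q a b z = N / D *
      ((1 - z\<^sup>2) * (1 - 1 / z\<^sup>2) * (1 - Q / z\<^sup>2) /
           ((1 - a * z) * (1 - a / z) * (1 - b * z) * (1 - b / z)))"
    unfolding asc_symbol_def Q_def [symmetric] s1 s2 s5 [of a] s5 [of b] N_def D_def
    by (simp add: mult_ac)
  show ?thesis
    unfolding Q_def [symmetric] G1 G2 W right_diff_distrib [symmetric] mult.assoc [of "N / D"]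
    by (intro arg_cong2 [where f = "(*)"] refl asc_primitive_rational_identity z0 Q0 nza nzb)
qed

lemma asc_weight_uminus: "asc_weight (- \<theta>) a b q = asc_weight \<theta> a b q"
  by (simp add: asc_weight_def mult_ac)

lemma continuous_on_asc_weight [continuous_intros]:
  assumes q: "0 < q" "q < 1" and ab: "norm a < 1" "norm b < 1"
  shows "continuous_on A (\<lambda>\<theta>. asc_weight \<theta> a b q)"
proof -
  have "qpoch_inf (c * cis t) q \<noteq> 0" if "norm c < 1" for c t
    using that by (intro qpoch_inf_nonzero q) (simp add: norm_mult)
  then show ?thesis
    unfolding asc_weight_def using assms by (intro continuous_intros) simp_all
qed

lemma integral_even:
  fixes f :: "real \<Rightarrow> complex"
  assumes "continuous_on {-c..c} f" "\<And>x. f (- x) = f x" "0 \<le> c"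
  shows "integral {-c..c} f = 2 * integral {0..c} f"
proof -
  have "integral {-c..0} f = integral {0..c} f"
    using Henstock_Kurzweil_Integration.integral_reflect_real [of c 0 f] assms(2) by simp
  moreover have "integral {-c..0} f + integral {0..c} f = integral {-c..c} f"
    using assms by (intro Henstock_Kurzweil_Integration.integral_combine integrable_continuous_real) auto
  ultimately show ?thesis by simp
qed

text \<open>The contour can be moved from the circle \<open>|z| = 1\<close> to \<open>|z| = 1 / q\<close>, because for \<open>|a|, |b| < 1\<close> the
  denominator \<open>(q a z, a / z, q b z, b / z; q)\<^sub>\<infinity>\<close> has no zeros in between. So the two terms of the
  antidifference cancel.\<close>
lemma asc_first_moment:
  assumes q: "0 < q" "q < 1" and ab: "norm a < 1" "norm b < 1"
  shows "integral {0..pi} (\<lambda>\<theta>. asc_weight \<theta> a b q * (2 * of_real (cos \<theta>) - a - b)) = 0"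
proof -
  define Q where "Q = complex_of_real q"
  have Q0: "Q \<noteq> 0" using q by (auto simp: Q_def)
  \<comment> \<open>an open annulus on which no factor of the denominator vanishes\<close>
  define S where "S = {z :: complex. norm a < norm z \<and> norm b < norm z \<and> 0 < norm z \<and>
      q * norm a * norm z < 1 \<and> q * norm b * norm z < 1}"
  have "open S" unfolding S_def
    by (intro open_Collect_conj open_Collect_less continuous_intros)
  have nzS: "qpoch_inf (Q * c * z) q \<noteq> 0" "qpoch_inf (c / z) q \<noteq> 0"
    if "z \<noteq> 0" "norm c < norm z" "q * norm c * norm z < 1" for c z
    by (intro qpoch_inf_nonzero q; use q that in \<open>simp add: norm_mult norm_divide Q_def\<close>)+
  have hol: "asc_primitive q a b holomorphic_on S"
    unfolding asc_primitive_def [abs_def] Q_def [symmetric] using q nzS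
    by (intro holomorphic_intros) (auto simp: S_def)
  have sub: "{z. 1 \<le> norm z \<and> norm z \<le> 1 / q} \<subseteq> S"
  proof
    fix z :: complex assume z: "z \<in> {z. 1 \<le> norm z \<and> norm z \<le> 1 / q}"
    have "q * norm c * norm z < 1" if "norm c < 1" for c :: complex
    proof -
      have "norm c * (q * norm z) \<le> norm c * 1"
        using z q by (intro mult_left_mono) (auto simp: field_simps)
      then show ?thesis using that by (simp add: mult_ac)
    qed
    then show "z \<in> S" using z ab by (auto simp: S_def)
  qed
  have "1 \<le> 1 / q" using q by simp
  have eq: "integral {-pi..pi} (\<lambda>t. asc_primitive q a b (cis t)) =
      integral {-pi..pi} (\<lambda>t. asc_primitive q a b (cis t / Q))"
    using circle_mean_eq [OF \<open>open S\<close> hol _ \<open>1 \<le> 1 / q\<close> sub] by (simp add: Q_def)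
  have cont: "continuous_on A (\<lambda>t. asc_primitive q a b (of_real r * cis t))" if "1 \<le> r" "r \<le> 1 / q" for r A
  proof (rule continuous_on_compose2 [OF holomorphic_on_imp_continuous_on [OF hol]])
    show "(\<lambda>t. of_real r * cis t) ` A \<subseteq> S"
      using that by (intro order.trans [OF _ sub]) (auto simp: norm_mult)
  qed (intro continuous_intros)
  have int: "(\<lambda>t. asc_primitive q a b (cis t)) integrable_on {-pi..pi}"
    "(\<lambda>t. asc_primitive q a b (cis t / Q)) integrable_on {-pi..pi}"
    using cont [of 1] cont [of "1 / q"] q
    by (auto intro!: integrable_continuous_real simp: Q_def)
  have "integral {-pi..pi} (\<lambda>\<theta>. asc_weight \<theta> a b q * (2 * of_real (cos \<theta>) - a - b)) =
      integral {-pi..pi} (\<lambda>t. asc_primitive q a b (cis t) - asc_primitive q a b (cis t / Q))"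
  proof (rule integral_cong)
    fix t
    have "1 / cis t = cis (- t)" by (simp add: divide_eq_eq cis_mult)
    then have "cis t + 1 / cis t = 2 * of_real (cos t)"
      by (simp add: complex_eq_iff)
    then show "asc_weight t a b q * (2 * of_real (cos t) - a - b) =
        asc_primitive q a b (cis t) - asc_primitive q a b (cis t / Q)"
      using asc_primitive_diff [OF q ab, of "cis t"] by (simp add: asc_weight_eq_symbol Q_def)
  qed
  also have "\<dots> = 0"
    using eq int by (subst Henstock_Kurzweil_Integration.integral_diff) auto
  finally have "integral {-pi..pi} (\<lambda>\<theta>. asc_weight \<theta> a b q * (2 * of_real (cos \<theta>) - a - b)) = 0" .
  moreover have "integral {-pi..pi} (\<lambda>\<theta>. asc_weight \<theta> a b q * (2 * of_real (cos \<theta>) - a - b)) =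
      2 * integral {0..pi} (\<lambda>\<theta>. asc_weight \<theta> a b q * (2 * of_real (cos \<theta>) - a - b))"
    using q ab by (intro integral_even continuous_intros) (auto simp: asc_weight_uminus)
  ultimately show ?thesis by simp
qed

definition asc_total_mass :: "real \<Rightarrow> complex \<Rightarrow> complex \<Rightarrow> complex" where
  "asc_total_mass q a b = integral {0..pi} (\<lambda>\<theta>. asc_weight \<theta> a b q)"

lemma asc_weight_shift:
  assumes q: "0 < q" "q < 1" and ab: "norm a < 1" "norm b < 1"
  shows "asc_weight \<theta> (a * of_real q ^ l) (b * of_real q ^ m) q =
    poly (asc_basis a q l) (of_real (cos \<theta>)) * poly (asc_basis b q m) (of_real (cos \<theta>)) *
      asc_weight \<theta> a b q"
proof -
  have split: "qpoch_inf (c * z) q = qpoch (c * z) q k * qpoch_inf (c * of_real q ^ k * z) q" for c z k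
    using qpoch_inf_split [OF q, of "c * z" k] by (simp add: mult_ac)
  have nz: "qpoch (c * cis t) q k \<noteq> 0" if "norm c < 1" for c t k
    using that by (intro qpoch_nonzero q) (simp add: norm_mult)
  show ?thesis
    unfolding asc_weight_def poly_asc_basis_cos
      split [of a "cis \<theta>" l] split [of a "cis (- \<theta>)" l]
      split [of b "cis \<theta>" m] split [of b "cis (- \<theta>)" m]
    using nz [OF ab(1)] nz [OF ab(2)] by simp
qed

lemma asc_total_mass_commute: "asc_total_mass q a b = asc_total_mass q b a"
  by (simp add: asc_total_mass_def asc_weight_def mult_ac)

text \<open>The weight at \<open>a q\<close> is \<open>1 + a\<^sup>2 - 2 a cos \<theta>\<close> times the weight at \<open>a\<close>, and this factor differs from
  \<open>1 - a b\<close> by \<open>- a (2 cos \<theta> - a - b)\<close>, which integrates to zero.\<close>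
lemma asc_total_mass_step:
  assumes q: "0 < q" "q < 1" and ab: "norm a < 1" "norm b < 1"
  shows "asc_total_mass q (a * of_real q) b = (1 - a * b) * asc_total_mass q a b"
proof -
  have int: "(\<lambda>\<theta>. asc_weight \<theta> a b q) integrable_on {0..pi}"
    "(\<lambda>\<theta>. asc_weight \<theta> a b q * (2 * of_real (cos \<theta>) - a - b)) integrable_on {0..pi}"
    using q ab by (auto intro!: integrable_continuous_real continuous_intros)
  have "asc_weight \<theta> (a * of_real q) b q =
      (1 - a * b) * asc_weight \<theta> a b q - a * (asc_weight \<theta> a b q * (2 * of_real (cos \<theta>) - a - b))" for \<theta>
    using asc_weight_shift [OF q ab, of \<theta> 1 0]
    by (simp add: asc_basis_def algebra_simps power2_eq_square)
  then have "asc_total_mass q (a * of_real q) b = (1 - a * b) * asc_total_mass q a b -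
      a * integral {0..pi} (\<lambda>\<theta>. asc_weight \<theta> a b q * (2 * of_real (cos \<theta>) - a - b))"
    using int by (simp add: asc_total_mass_def Henstock_Kurzweil_Integration.integral_diff integrable_on_mult_right)
  then show ?thesis by (simp add: asc_first_moment [OF q ab])
qed

lemma asc_total_mass_shift:
  assumes q: "0 < q" "q < 1" and ab: "norm a < 1" "norm b < 1"
  shows "asc_total_mass q (a * of_real q ^ l) (b * of_real q ^ m) = qpoch (a * b) q (l + m) * asc_total_mass q a b"
proof -
  have 1: "asc_total_mass q (a * of_real q ^ l) b = qpoch (a * b) q l * asc_total_mass q a b"
    if "norm a < 1" "norm b < 1" for a b l
  proof (induction l)
    case (Suc l)
    then show ?case
      using asc_total_mass_step [OF q norm_times_power_less_1 [OF q that(1)] that(2), of l]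
      by (simp add: qpoch_Suc mult_ac)
  qed simp
  have b': "norm (b * of_real q ^ m) < 1" by (rule norm_times_power_less_1 [OF q ab(2)])
  show ?thesis
    using 1 [OF ab(1) b', of l] 1 [OF ab(2,1), of m] asc_total_mass_commute [of q a] 
    by (simp add: add.commute [of l] qpoch_add mult_ac)
qed

text \<open>The analogue of \<open>little_q_laguerre_moment\<close>: products of the two bases shift the parameters of the
  weight, and the resulting masses are \<open>(a b; q)\<^sub>l\<^sub>+\<^sub>m I(a, b) = (a b; q)\<^sub>l (a b q\<^sup>l; q)\<^sub>m I(a, b)\<close>. Using the
  basis with parameter \<open>a\<close> for the test polynomials is what makes this work.\<close>
lemma asc_orthogonality_pairing:
  assumes q: "0 < q" "q < 1" and ab: "norm a < 1" "norm b < 1"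
  shows "integral {0..pi} (\<lambda>\<theta>. poly (basis_map (asc_basis b q) p) (of_real (cos \<theta>)) *
            poly (basis_map (asc_basis a q) g) (of_real (cos \<theta>)) * asc_weight \<theta> a b q) =
         asc_total_mass q a b * (\<Sum>l\<le>degree g. coeff g l * qpoch (a * b) q l *
            poly (basis_map (qpoch_poly q) p) (a * b * of_real q ^ l))"
proof -
  have int: "(\<lambda>\<theta>. asc_weight \<theta> (a * of_real q ^ l) (b * of_real q ^ m) q) integrable_on {0..pi}" for l m
    using q ab by (intro integrable_continuous_real continuous_intros norm_times_power_less_1)
  have double_sum: "(\<Sum>m\<in>M. u m) * (\<Sum>l\<in>L. v l) * w = (\<Sum>l\<in>L. \<Sum>m\<in>M. v l * u m * w)"
    for M L :: "nat set" and u v :: "nat \<Rightarrow> complex" and w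
    by (subst mult.commute [of "sum u M"], subst sum_product) (simp only: sum_distrib_right)
  have "integral {0..pi} (\<lambda>\<theta>. poly (basis_map (asc_basis b q) p) (of_real (cos \<theta>)) *
            poly (basis_map (asc_basis a q) g) (of_real (cos \<theta>)) * asc_weight \<theta> a b q) =
        integral {0..pi} (\<lambda>\<theta>. \<Sum>l\<le>degree g. \<Sum>m\<le>degree p. coeff g l * coeff p m *
          asc_weight \<theta> (a * of_real q ^ l) (b * of_real q ^ m) q)"
    unfolding basis_map_def poly_sum poly_smult asc_weight_shift [OF q ab] double_sum
    by (intro integral_cong sum.cong refl) (simp only: mult_ac)
  also have "\<dots> = (\<Sum>l\<le>degree g. \<Sum>m\<le>degree p. coeff g l * coeff p m *
          asc_total_mass q (a * of_real q ^ l) (b * of_real q ^ m))"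
    using int by (simp add: integral_sum asc_total_mass_def integrable_on_mult_right integrable_sum)
  also have "\<dots> = asc_total_mass q a b * (\<Sum>l\<le>degree g. coeff g l * qpoch (a * b) q l *
            poly (basis_map (qpoch_poly q) p) (a * b * of_real q ^ l))"
    unfolding asc_total_mass_shift [OF q ab] qpoch_add basis_map_def poly_sum poly_smult poly_qpoch_poly
      sum_distrib_left
    by (intro sum.cong refl) (simp add: mult_ac)
  finally show ?thesis .
qed

text \<open>The substitution \<open>x = cos \<theta>\<close>. The integrand may be unbounded at \<open>x = -1\<close> and \<open>x = 1\<close>, so the fundamental theorem of
  calculus is applied to an antiderivative that is continuous on the closed interval and
  differentiable in its interior.\<close>
lemma has_integral_arccos:
  fixes f :: "real \<Rightarrow> complex"
  assumes f: "continuous_on {0..pi} f"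
  shows "((\<lambda>x. f (arccos x) / of_real (sqrt (1 - x\<^sup>2))) has_integral integral {0..pi} f) {-1..1}"
proof -
  define \<Phi> where "\<Phi> = (\<lambda>u. integral {0..u} f)"
  define g where "g = (\<lambda>x. - \<Phi> (arccos x))"
  have cont: "continuous_on {0..pi} \<Phi>"
    unfolding \<Phi>_def using f by (intro indefinite_integral_continuous_1 integrable_continuous_real)
  have "((\<lambda>x. f (arccos x) / of_real (sqrt (1 - x\<^sup>2))) has_integral (g 1 - g (-1))) {-1..1}"
  proof (rule fundamental_theorem_of_calculus_interior)
    show "continuous_on {-1..1} g"
      unfolding g_def
      by (intro continuous_on_minus continuous_on_compose2 [OF cont] continuous_on_arccos')
         (auto simp: arccos_lbound arccos_ubound)
  next
    fix x :: real assume x: "x \<in> {-1<..<1}"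
    then have ax: "arccos x \<in> {0<..<pi}" using arccos_lt_bounded [of x] by auto
    have "(\<Phi> has_vector_derivative f (arccos x)) (at (arccos x) within {0..pi})"
      unfolding \<Phi>_def using ax by (intro integral_has_vector_derivative f) auto
    then have "(\<Phi> has_vector_derivative f (arccos x)) (at (arccos x))"
      using ax at_within_interior [of "arccos x" "{0..pi}"] by simp
    moreover have "(arccos has_vector_derivative inverse (- sqrt (1 - x\<^sup>2))) (at x)"
      using DERIV_arccos [of x] x by (simp add: has_real_derivative_iff_has_vector_derivative)
    ultimately have "(\<Phi> \<circ> arccos has_vector_derivative inverse (- sqrt (1 - x\<^sup>2)) *\<^sub>R f (arccos x)) (at x)"
      by (intro vector_diff_chain_at)
    then have "(g has_vector_derivative - (inverse (- sqrt (1 - x\<^sup>2)) *\<^sub>R f (arccos x))) (at x)"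
      unfolding g_def o_def by (rule has_vector_derivative_minus)
    then show "(g has_vector_derivative f (arccos x) / of_real (sqrt (1 - x\<^sup>2))) (at x)"
      by (simp add: scaleR_conv_of_real field_simps)
  qed simp
  then show ?thesis by (simp add: g_def \<Phi>_def)
qed

section \<open>The multiple little q-Laguerre polynomial\<close>

lemma is_mult_little_q_laguerre_iff:
  assumes q: "0 < q" "q < 1" and t: "\<forall>j\<in>{1..r}. norm (A j * of_real q) < 1"
  shows "is_mult_little_q_laguerre r n A q p \<longleftrightarrow>
     degree p = (\<Sum>j=1..r. n j) \<and> poly p 0 = 1 \<and>
     (\<forall>j\<in>{1..r}. \<forall>l<n j. poly (basis_map (qpoch_poly q) p) (A j * of_real q * of_real q ^ l) = 0)"
proof -
  have "(\<lambda>k. poly p (of_real q ^ k) * of_real q ^ (k * l) *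
              ((A j * of_real q) ^ k / qpoch (of_real q) q k)) sums 0 \<longleftrightarrow>
        poly (basis_map (qpoch_poly q) p) (A j * of_real q * of_real q ^ l) = 0" if "j \<in> {1..r}" for j l
  proof -
    note moment = little_q_laguerre_moment [OF q bspec [OF t that], of p l]
    have "q_exponential q (A j * of_real q) * qpoch (A j * of_real q) q l \<noteq> 0"
      using q_exponential_nonzero [OF q bspec [OF t that]] qpoch_nonzero [OF bspec [OF t that] q] by simp
    moreover have "X sums 0 \<longleftrightarrow> y = 0" if "X sums (c * y)" "c \<noteq> 0" for X and c y :: complex
      using that sums_unique2 [OF that(1), of 0] by auto
    ultimately show ?thesis using moment by blast
  qed
  then show ?thesis by (simp add: is_mult_little_q_laguerre_def)
qed

lemma geometric_nodes_inj:
  assumes q: "0 < q" "q < 1" and t0: "\<And>j. j \<in> J \<Longrightarrow> t j \<noteq> 0"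
    and ratio: "\<And>i j (m::int). i \<in> J \<Longrightarrow> j \<in> J \<Longrightarrow> i \<noteq> j \<Longrightarrow> t i / t j \<noteq> of_real q powi m"
  shows "inj_on (\<lambda>(j, l). t j * of_real q ^ l :: complex) (SIGMA j:J. {..<n j})"
proof (rule inj_onI, clarify)
  fix i l j m assume ij: "i \<in> J" "j \<in> J" and eq: "t i * of_real q ^ l = t j * (of_real q ^ m :: complex)"
  have "t i / t j = of_real q powi (int m - int l)"
    using eq t0 [OF ij(2)] q by (simp add: power_int_diff field_simps)
  with ratio ij have ij': "i = j" by blast
  with eq t0 [OF ij(2)] have "(of_real (q ^ l) :: complex) = of_real (q ^ m)" by simp
  then have "q ^ l = q ^ m" by (simp only: of_real_eq_iff)
  then have "l = m"
    using q power_strict_decreasing [of l m q] power_strict_decreasing [of m l q]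
    by (metis less_irrefl linorder_neqE_nat)
  with ij' show "i = j \<and> l = m" by simp
qed

text \<open>The uniqueness argument: the nodes together with \<open>1\<close> are one more point than the degree allows. The
  hypothesis on the ratios \<open>t i / t j\<close> is what keeps nodes from different geometric progressions apart.\<close>
lemma polynomial_zero_by_nodes:
  fixes r :: nat
  assumes q: "0 < q" "q < 1"
    and t: "\<And>j. j \<in> {1..r} \<Longrightarrow> t j \<noteq> 0" "\<And>j. j \<in> {1..r} \<Longrightarrow> norm (t j) < 1"
    and ratio: "\<And>i j (m::int). i \<in> {1..r} \<Longrightarrow> j \<in> {1..r} \<Longrightarrow> i \<noteq> j \<Longrightarrow> t i / t j \<noteq> of_real q powi m"
    and deg: "degree s \<le> (\<Sum>j=1..r. n j)" and one: "poly s 1 = 0"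
    and nodes: "\<And>j l. j \<in> {1..r} \<Longrightarrow> l < n j \<Longrightarrow> poly s (t j * of_real q ^ l) = 0"
  shows "s = (0 :: complex poly)"
proof (rule ccontr)
  assume s: "s \<noteq> 0"
  define Z where "Z = (\<lambda>(j, l). t j * of_real q ^ l) ` (SIGMA j:{1..r}. {..<n j})"
  have "card Z = (\<Sum>j=1..r. n j)"
    unfolding Z_def by (subst card_image [OF geometric_nodes_inj [OF q t(1) ratio]]) simp_all
  moreover have "1 \<notin> Z"
  proof
    assume "1 \<in> Z"
    then obtain j l where "j \<in> {1..r}" "1 = t j * of_real q ^ l" by (auto simp: Z_def)
    with norm_times_power_less_1 [OF q t(2), of j l] show False by (metis norm_one less_irrefl)
  qed
  moreover have "finite Z" by (simp add: Z_def)
  ultimately have "card (insert 1 Z) = Suc (\<Sum>j=1..r. n j)" by simp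
  moreover have "card (insert 1 Z) \<le> card {x. poly s x = 0}"
    using one nodes by (intro card_mono poly_roots_finite s) (auto simp: Z_def)
  moreover have "card {x. poly s x = 0} \<le> degree s" by (rule card_poly_roots_bound [OF s])
  ultimately show False using deg by linarith
qed

definition mlql_poly :: "nat \<Rightarrow> (nat \<Rightarrow> nat) \<Rightarrow> (nat \<Rightarrow> complex) \<Rightarrow> real \<Rightarrow> complex poly" where
  "mlql_poly r n t q = (\<Sum>k\<in>PiE {1..r} (\<lambda>j. {0..n j}). monom (mlql_coeff 1 r n t q k) (\<Sum>j=1..r. k j))"

text \<open>The multiple \<open>q\<close>-Chu--Vandermonde formula, read as an identity of polynomials in \<open>x\<close>.\<close>
lemma basis_map_mlql_poly:
  assumes q: "0 < q" "q < 1" and t: "\<And>j. j \<in> {1..r} \<Longrightarrow> norm (t j) < 1"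
  shows "basis_map (qpoch_poly q) (mlql_poly r n t q) =
    (\<Prod>j=1..r. \<Prod>l<n j. [: - (t j * of_real q ^ l) / (1 - t j * of_real q ^ l), 1 / (1 - t j * of_real q ^ l) :])"
proof -
  have "poly (basis_map (qpoch_poly q) (mlql_poly r n t q)) x =
     (\<Prod>j=1..r. \<Prod>l<n j. (x - t j * of_real q ^ l) / (1 - t j * of_real q ^ l))" for x
    unfolding mlql_poly_def basis_map_sum basis_map_monom poly_sum poly_smult poly_qpoch_poly
    by (intro multiple_q_chu_vandermonde q qpoch_nonzero t)
  then have "poly (basis_map (qpoch_poly q) (mlql_poly r n t q)) x = poly
    (\<Prod>j=1..r. \<Prod>l<n j. [: - (t j * of_real q ^ l) / (1 - t j * of_real q ^ l), 1 / (1 - t j * of_real q ^ l) :]) x" for x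
    by (simp add: poly_prod diff_divide_distrib)
  then show ?thesis by (intro poly_eq_poly_eq_iff [THEN iffD1] ext)
qed

text \<open>Degree, value at \<open>0\<close> and zeros can all be read off from the product form of the image in the basis
  \<open>(x; q)\<^sub>k\<close>.\<close>
lemma mult_little_q_laguerre_explicit:
  assumes q: "0 < q" "q < 1"
    and t: "\<And>j. j \<in> {1..r} \<Longrightarrow> A j \<noteq> 0" "\<And>j. j \<in> {1..r} \<Longrightarrow> norm (A j * of_real q) < 1"
    and ratio: "\<And>i j (m::int). i \<in> {1..r} \<Longrightarrow> j \<in> {1..r} \<Longrightarrow> i \<noteq> j \<Longrightarrow> A i / A j \<noteq> of_real q powi m"
  shows "mult_little_q_laguerre r n A q = mlql_poly r n (\<lambda>j. A j * of_real q) q"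
    and "is_mult_little_q_laguerre r n A q (mlql_poly r n (\<lambda>j. A j * of_real q) q)"
proof -
  define t' where "t' = (\<lambda>j. A j * of_real q)"
  define P where "P = mlql_poly r n t' q"
  have q0: "q \<noteq> 0" using q by simp
  have norm_A: "\<forall>j\<in>{1..r}. norm (A j * of_real q) < 1" using t(2) by blast
  have L: "basis_map (qpoch_poly q) P =
    (\<Prod>j=1..r. \<Prod>l<n j. [: - (t' j * of_real q ^ l) / (1 - t' j * of_real q ^ l), 1 / (1 - t' j * of_real q ^ l) :])"
    unfolding P_def t'_def by (intro basis_map_mlql_poly q t)
  have nz: "1 - t' j * of_real q ^ l \<noteq> 0" if "j \<in> {1..r}" for j l
    unfolding t'_def by (intro one_minus_times_power_nonzero q t that)
  have "degree (basis_map (qpoch_poly q) P) = (\<Sum>j=1..r. n j)"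
    unfolding L using nz
    by (subst degree_prod_eq_sum_degree, simp)
       (intro sum.cong refl, subst degree_prod_eq_sum_degree, auto)
  then have "degree P = (\<Sum>j=1..r. n j)"
    by (simp add: degree_basis_map degree_qpoch_poly q0)
  moreover have "poly P 0 = 1"
    unfolding poly_basis_map_qpoch_poly_1 [symmetric, where q = q] L using nz
    by (simp add: poly_prod diff_divide_distrib [symmetric])
  moreover have "poly (basis_map (qpoch_poly q) P) (A j * of_real q * of_real q ^ l) = 0"
    if "j \<in> {1..r}" "l < n j" for j l
    unfolding L poly_prod
    by (rule prod_zero, simp, rule bexI [of _ j], rule prod_zero, simp, rule bexI [of _ l])
       (use that in \<open>simp_all add: t'_def\<close>)
  ultimately have isP: "is_mult_little_q_laguerre r n A q P"
    using is_mult_little_q_laguerre_iff [OF q norm_A] by blast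
  then show "is_mult_little_q_laguerre r n A q (mlql_poly r n (\<lambda>j. A j * of_real q) q)"
    by (simp add: P_def t'_def)
  have "p = P" if "is_mult_little_q_laguerre r n A q p" for p
  proof -
    note p = that [unfolded is_mult_little_q_laguerre_iff [OF q norm_A]]
    note P = isP [unfolded is_mult_little_q_laguerre_iff [OF q norm_A]]
    have "basis_map (qpoch_poly q) (p - P) = 0"
    proof (rule polynomial_zero_by_nodes [OF q])
      show "degree (basis_map (qpoch_poly q) (p - P)) \<le> (\<Sum>j=1..r. n j)"
        using p P by (simp add: degree_basis_map degree_qpoch_poly q0 degree_diff_le)
      show "poly (basis_map (qpoch_poly q) (p - P)) 1 = 0"
        using p P by (simp add: poly_basis_map_qpoch_poly_1)
      show "poly (basis_map (qpoch_poly q) (p - P)) (A j * of_real q * of_real q ^ l) = 0"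
        if "j \<in> {1..r}" "l < n j" for j l
        using p P that by (simp add: basis_map_diff)
      show "A i * of_real q / (A j * of_real q) \<noteq> of_real q powi m"
        if "i \<in> {1..r}" "j \<in> {1..r}" "i \<noteq> j" for i j and m :: int
        using ratio [OF that] q by simp
    qed (use q t in auto)
    then show "p = P"
      by (simp add: basis_map_eq_0_iff degree_qpoch_poly q0)
  qed
  with isP show "mult_little_q_laguerre r n A q = mlql_poly r n (\<lambda>j. A j * of_real q) q"
    unfolding mult_little_q_laguerre_def P_def [symmetric] t'_def [symmetric]
    by (intro the_equality)
qed

section \<open>The multiple Al-Salam--Chihara polynomial\<close>

text \<open>The test monomial \<open>x ^ l\<close> is expanded in the basis \<open>(a\<^sub>j e\<^sup>i\<^sup>\<theta>, a\<^sub>j e\<^sup>-\<^sup>i\<^sup>\<theta>; q)\<^sub>i\<close> with \<open>i \<le> l\<close>, which is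
  possible because \<open>a\<^sub>j \<noteq> 0\<close>; each term then pairs to zero.\<close>
lemma is_mult_al_salam_chihara_basis_map:
  assumes q: "0 < q" "q < 1" and b: "norm b < 1" "b \<noteq> 0"
    and a: "\<And>j. j \<in> {1..r} \<Longrightarrow> norm (a j) < 1" "\<And>j. j \<in> {1..r} \<Longrightarrow> a j \<noteq> 0"
    and deg: "degree P = (\<Sum>j=1..r. n j)"
    and zero: "\<And>j l. j \<in> {1..r} \<Longrightarrow> l < n j \<Longrightarrow>
       poly (basis_map (qpoch_poly q) P) (a j * b * of_real q ^ l) = 0"
  shows "is_mult_al_salam_chihara r n a b q (asc_T b q P)"
  unfolding is_mult_al_salam_chihara_def
proof (intro conjI ballI allI impI)
  show "degree (asc_T b q P) = (\<Sum>j=1..r. n j)"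
    using b q deg by (simp add: asc_T_eq_basis_map degree_basis_map degree_asc_basis)
next
  fix j l assume j: "j \<in> {1..r}" and l: "l < n j"
  have basis: "degree (asc_basis (a j) q k) = k" "asc_basis (a j) q 0 \<noteq> 0" for k
    using a(2) [OF j] q by (simp_all add: degree_asc_basis)
  obtain g where g: "basis_map (asc_basis (a j) q) g = monom 1 l"
    using basis_map_surj [OF basis] by blast
  then have "degree g = l"
    using degree_basis_map [OF basis, of g] by (simp add: degree_monom_eq)
  define f where "f = (\<lambda>\<theta>. poly (asc_T b q P) (of_real (cos \<theta>)) * of_real (cos \<theta>) ^ l *
      asc_weight \<theta> (a j) b q)"
  have "integral {0..pi} f = asc_total_mass q (a j) b * (\<Sum>i\<le>degree g. coeff g i * qpoch (a j * b) q i *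
            poly (basis_map (qpoch_poly q) P) (a j * b * of_real q ^ i))"
    using asc_orthogonality_pairing [OF q a(1) [OF j] b(1), of P g]
    by (simp add: g f_def asc_T_eq_basis_map poly_monom)
  also have "\<dots> = 0" using zero [OF j] l \<open>degree g = l\<close> by simp
  finally have "integral {0..pi} f = 0" .
  moreover have "continuous_on {0..pi} f"
    unfolding f_def by (intro continuous_intros q a j b)
  ultimately have "((\<lambda>x. f (arccos x) / of_real (sqrt (1 - x\<^sup>2))) has_integral 0) {-1..1}"
    using has_integral_arccos [of f] by simp
  then show "((\<lambda>x. poly (asc_T b q P) (of_real x) * of_real x ^ l * asc_weight (arccos x) (a j) b q /
               of_real (sqrt (1 - x\<^sup>2))) has_integral 0) {-1..1}"
    by (rule has_integral_eq [rotated]) (simp add: f_def cos_arccos)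
qed

lemma mlql_coeff_alt:
  assumes "r \<ge> 1"
  shows "mlql_coeff 1 r n t q k =
         (\<Prod>j=1..r. qpoch (of_real q powi (- int (n j))) q (k j) /
                     (qpoch (of_real q) q (k j) * qpoch (t j) q (k j))) *
         (\<Prod>j=1..r-1. qpoch (t j * of_real q ^ n j) q (\<Sum>i=j+1..r. k i) /
                       qpoch (t j * of_real q ^ k j) q (\<Sum>i=j+1..r. k i)) *
         (of_real q ^ (\<Sum>j=1..r. k j) / of_real q ^ (\<Sum>j=1..r. n j * (\<Sum>i=j+1..r. k i)))"
proof -
  have "(\<Prod>j=1..r-1. qpoch (t j * of_real q ^ n j) q (\<Sum>i=j+1..r. k i) /
                       qpoch (t j * of_real q ^ k j) q (\<Sum>i=j+1..r. k i)) =
        (\<Prod>j=1..r. qpoch (t j * of_real q ^ n j) q (\<Sum>i=j+1..r. k i) /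
                       qpoch (t j * of_real q ^ k j) q (\<Sum>i=j+1..r. k i))"
  proof (rule prod.mono_neutral_left)
    show "\<forall>j\<in>{1..r} - {1..r-1}. qpoch (t j * of_real q ^ n j) q (\<Sum>i=j+1..r. k i) /
                       qpoch (t j * of_real q ^ k j) q (\<Sum>i=j+1..r. k i) = 1"
    proof
      fix j assume "j \<in> {1..r} - {1..r-1}"
      then have "j = r" by auto
      then show "qpoch (t j * of_real q ^ n j) q (\<Sum>i=j+1..r. k i) /
                       qpoch (t j * of_real q ^ k j) q (\<Sum>i=j+1..r. k i) = 1" by simp
    qed
  qed auto
  then show ?thesis
    unfolding mlql_coeff_def by (simp only: prod.distrib prod_dividef power_sum)
qed

theorem theorem3p3:
  fixes q :: real and r :: nat and n :: "nat \<Rightarrow> nat"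
    and a \<alpha> :: "nat \<Rightarrow> complex" and b :: complex and p :: "complex poly"
  assumes "0 < q" and "q < 1" and "r \<ge> 1"
    and "\<And>j. j \<in> {1..r} \<Longrightarrow> norm (a j) < 1" and "norm b < 1" and "b \<noteq> 0"
    and "\<And>j. j \<in> {1..r} \<Longrightarrow> a j = of_real q powr \<alpha> j"
    and "\<And>i j (m::int). i \<in> {1..r} \<Longrightarrow> j \<in> {1..r} \<Longrightarrow> i \<noteq> j \<Longrightarrow>
           a i / a j \<noteq> of_real q powi m"
    and "p = asc_T b q (mult_little_q_laguerre r n (\<lambda>j. b / of_real q * a j) q)"
  shows "is_mult_al_salam_chihara r n a b q p \<and>
    (\<forall>\<theta>::real. poly p (of_real (cos \<theta>)) =
      (\<Sum>k \<in> PiE {1..r} (\<lambda>j. {0..n j}).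
         (\<Prod>j=1..r. qpoch (of_real q powi (- int (n j))) q (k j) /
                     (qpoch (of_real q) q (k j) * qpoch (a j * b) q (k j))) *
         (\<Prod>j=1..r-1. qpoch (a j * b * of_real q ^ n j) q (\<Sum>i=j+1..r. k i) /
                       qpoch (a j * b * of_real q ^ k j) q (\<Sum>i=j+1..r. k i)) *
         (of_real q ^ (\<Sum>j=1..r. k j) / of_real q ^ (\<Sum>j=1..r. n j * (\<Sum>i=j+1..r. k i))) *
         (qpoch (b * cis \<theta>) q (\<Sum>j=1..r. k j) * qpoch (b * cis (- \<theta>)) q (\<Sum>j=1..r. k j))))"
proof -
  note q = assms(1,2) and norm_a = assms(4) and b = assms(5,6) and ratio = assms(8)
  have a0: "a j \<noteq> 0" if "j \<in> {1..r}" for j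
    using assms(7) [OF that] q by simp
  define A where "A = (\<lambda>j. b / of_real q * a j)"
  have A_shift: "A j * of_real q = a j * b" for j
    using q by (simp add: A_def)
  have A: "A j \<noteq> 0" "norm (A j * of_real q) < 1" if "j \<in> {1..r}" for j
  proof -
    show "A j \<noteq> 0" using a0 [OF that] b q by (simp add: A_def)
    have "norm (a j) * norm b < 1 * 1"
      using norm_a [OF that] b by (intro mult_strict_mono') auto
    then show "norm (A j * of_real q) < 1" by (simp add: A_shift norm_mult)
  qed
  have norm_A: "\<forall>j\<in>{1..r}. norm (A j * of_real q) < 1" using A(2) by blast
  have A_ratio: "A i / A j \<noteq> of_real q powi m" if "i \<in> {1..r}" "j \<in> {1..r}" "i \<noteq> j" for i j and m :: int
    using ratio [OF that] b q by (simp add: A_def)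
  define P where "P = mlql_poly r n (\<lambda>j. a j * b) q"
  note explicit = mult_little_q_laguerre_explicit [where A = A and r = r and n = n, OF q A A_ratio, unfolded A_shift, folded P_def]
  have p: "p = asc_T b q P"
    using assms(9) explicit(1) by (simp add: A_def)
  have laguerre: "is_mult_little_q_laguerre r n A q P" by (rule explicit(2))
  have "is_mult_al_salam_chihara r n a b q p"
    unfolding p using laguerre [unfolded is_mult_little_q_laguerre_iff [OF q norm_A] A_shift]
    by (intro is_mult_al_salam_chihara_basis_map q b norm_a a0) auto
  moreover have "poly p (of_real (cos \<theta>)) = (\<Sum>k\<in>PiE {1..r} (\<lambda>j. {0..n j}). mlql_coeff 1 r n (\<lambda>j. a j * b) q k *
     (qpoch (b * cis \<theta>) q (\<Sum>j=1..r. k j) * qpoch (b * cis (- \<theta>)) q (\<Sum>j=1..r. k j)))" for \<theta>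
    unfolding p P_def mlql_poly_def asc_T_eq_basis_map basis_map_sum basis_map_monom poly_sum
      poly_smult poly_asc_basis_cos ..
  ultimately show ?thesis unfolding mlql_coeff_alt [OF assms(3)] by blast
qed

end
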